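(* (1) No nonmetrizable compact convex subset $K$ of a topological vector space $E$ is NY compact. (2) In particular, for a compact space $K$, the space $P(K)$ of all probability Radon measures on $K$ is NY compact if and only if $K$ is metrizable.
   Context: All topological spaces (including topological vector spaces) are assumed to be completely regular Hausdorff (Tikhonov). Given nonempty spaces $X_\gamma$ ($\gamma\in\Gamma$) and fixed points $a_\gamma\in X_\gamma$, the $\sigma$-product is $\sigma(X_\gamma,a_\gamma,\Gamma)=\{(x_\gamma)_{\gamma\in\Gamma}\in\prod_{\gamma\in\Gamma}X_\gamma:\ |\{\gamma\in\Gamma: x_\gamma\neq a_\gamma\}|<\omega\}$ with the topology inherited from the product. A compact space $K$ is NY compact if it can be embedded (homeomorphically) into some $\sigma$-product of metrizable compact spaces. $P(K)$ denotes the set of regular Borel (Radon) probability measures on $K$, equipped with the weak$^*$ topology inherited from $C(K)^*$. *)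

theory Defs
  imports "HOL-Analysis.Analysis" "HOL-Probability.Probability"
begin

subsection \<open>Topological vector spaces\<close>

(* A topology on a whole real vector space, rather than a type class, so that several topologies
   on the same vector space are possible.  Following the convention that all spaces are
   Tikhonov, complete regularity and the Hausdorff property are part of the notion. *)
definition topological_vector_space :: "'e::real_vector topology \<Rightarrow> bool" where
  "topological_vector_space E \<longleftrightarrow>
     topspace E = UNIV \<and>
     continuous_map (prod_topology E E) E (\<lambda>(x, y). x + y) \<and>
     continuous_map (prod_topology euclideanreal E) E (\<lambda>(t, x). t *\<^sub>R x) \<and>
     completely_regular_space E \<and> Hausdorff_space E"

subsection \<open>Sigma-products and NY compact spaces\<close>

definition sigma_product :: "('i \<Rightarrow> 'b topology) \<Rightarrow> ('i \<Rightarrow> 'b) \<Rightarrow> 'i set \<Rightarrow> ('i \<Rightarrow> 'b) topology" where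
  "sigma_product Y b \<Gamma> =
     subtopology (product_topology Y \<Gamma>) {x. finite {\<gamma> \<in> \<Gamma>. x \<gamma> \<noteq> b \<gamma>}}"

(* HOL cannot quantify existentially over types, so the definition takes the index set inside
   'a * 'a and the factors as spaces whose points lie in 'a.  This is no restriction: lemma
   NY_compactI below shows that a compact space embeddable into a sigma-product of metrizable
   compact spaces over arbitrary index and point types satisfies the definition. *)
definition NY_compact :: "'a topology \<Rightarrow> bool" where
  "NY_compact X \<longleftrightarrow> compact_space X \<and>
     (\<exists>(\<Gamma> :: ('a \<times> 'a) set) (Y :: 'a \<times> 'a \<Rightarrow> 'a topology) b f.
        (\<forall>\<gamma>\<in>\<Gamma>. compact_space (Y \<gamma>) \<and> metrizable_space (Y \<gamma>) \<and> b \<gamma> \<in> topspace (Y \<gamma>)) \<and>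
        embedding_map X (sigma_product Y b \<Gamma>) f)"

lemma Hausdorff_space_sigma_product:
  assumes "\<And>\<gamma>. \<gamma> \<in> \<Gamma> \<Longrightarrow> metrizable_space (Y \<gamma>)"
  shows "Hausdorff_space (sigma_product Y b \<Gamma>)"
  unfolding sigma_product_def
  by (intro Hausdorff_space_subtopology)
     (auto simp: Hausdorff_space_product_topology intro: assms metrizable_imp_Hausdorff_space)

lemma NY_compactI:
  fixes X :: "'a topology" and Y :: "'i \<Rightarrow> 'b topology" and \<Gamma> :: "'i set"
  assumes X: "compact_space X"
    and Y: "\<And>\<gamma>. \<gamma> \<in> \<Gamma> \<Longrightarrow> compact_space (Y \<gamma>)" "\<And>\<gamma>. \<gamma> \<in> \<Gamma> \<Longrightarrow> metrizable_space (Y \<gamma>)"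
    and b: "\<And>\<gamma>. \<gamma> \<in> \<Gamma> \<Longrightarrow> b \<gamma> \<in> topspace (Y \<gamma>)"
    and f: "embedding_map X (sigma_product Y b \<Gamma>) f"
  shows "NY_compact X"
proof (cases "topspace X = {}")
  case True
  have "embedding_map X (sigma_product (Y' :: 'a \<times> 'a \<Rightarrow> 'a topology) b' {}) (\<lambda>_ _. undefined)"
    for Y' b'
    using True Hausdorff_space_sigma_product[of "{}" Y' b'] X
    by (intro continuous_imp_embedding_map) (auto simp: continuous_map_on_empty2)
  then show ?thesis
    unfolding NY_compact_def using X by blast
next
  case False
  then obtain x0 where x0: "x0 \<in> topspace X" by blast
  have cf: "continuous_map X (sigma_product Y b \<Gamma>) f"
    using f unfolding embedding_map_def
    by (meson continuous_map_in_subtopology homeomorphic_imp_continuous_map)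
  then have cp: "continuous_map X (product_topology Y \<Gamma>) f"
    and fin: "\<And>x. x \<in> topspace X \<Longrightarrow> finite {\<gamma> \<in> \<Gamma>. f x \<gamma> \<noteq> b \<gamma>}"
    unfolding sigma_product_def continuous_map_in_subtopology by auto
  have inj: "inj_on f (topspace X)"
    using f unfolding embedding_map_def using homeomorphic_imp_injective_map by blast
  have ext: "f x \<in> extensional \<Gamma>" if "x \<in> topspace X" for x
    using cp that unfolding continuous_map_componentwise by blast
  have cg: "continuous_map X (Y \<gamma>) (\<lambda>x. f x \<gamma>)" if "\<gamma> \<in> \<Gamma>" for \<gamma>
    using cp that unfolding continuous_map_componentwise by blast
  define sel where "sel = (\<lambda>(x, y). SOME \<gamma>. \<gamma> \<in> \<Gamma> \<and> f x \<gamma> \<noteq> f y \<gamma>)"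
  define D where "D = {(x, y). x \<in> topspace X \<and> y \<in> topspace X \<and> x \<noteq> y}"
  have sel: "sel (x, y) \<in> \<Gamma> \<and> f x (sel (x, y)) \<noteq> f y (sel (x, y))" if "(x, y) \<in> D" for x y
  proof -
    have "x \<in> topspace X" "y \<in> topspace X" "x \<noteq> y" using that by (auto simp: D_def)
    then have "\<exists>\<gamma>. \<gamma> \<in> \<Gamma> \<and> f x \<gamma> \<noteq> f y \<gamma>"
      using ext inj by (metis extensionalityI inj_onD)
    from someI_ex[OF this] show ?thesis by (simp add: sel_def)
  qed
  obtain \<Delta> where \<Delta>: "\<Delta> \<subseteq> D" "inj_on sel \<Delta>" "sel ` D = sel ` \<Delta>"
    using subset_image_inj[of "sel ` D" sel D] by auto
  have sel\<Gamma>: "sel q \<in> \<Gamma>" if "q \<in> \<Delta>" for q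
    using sel \<Delta>(1) that by (cases q) auto
  define p where "p = (\<lambda>\<gamma> x. f x \<gamma>)"
  define s where "s = (\<lambda>\<gamma>. inv_into (topspace X) (p \<gamma>))"
  define Z where "Z = (\<lambda>\<gamma>. pullback_topology (s \<gamma> ` p \<gamma> ` topspace X) (p \<gamma>)
                         (subtopology (Y \<gamma>) (p \<gamma> ` topspace X)))"
  define c where "c = (\<lambda>\<gamma>. s \<gamma> (if b \<gamma> \<in> p \<gamma> ` topspace X then b \<gamma> else p \<gamma> x0))"
  define g where "g = (\<lambda>x. \<lambda>q\<in>\<Delta>. s (sel q) (p (sel q) x))"
  have ps: "p \<gamma> (s \<gamma> v) = v" if "v \<in> p \<gamma> ` topspace X" for \<gamma> v
    using that unfolding s_def by (rule f_inv_into_f)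
  have sub: "p \<gamma> ` topspace X \<subseteq> topspace (Y \<gamma>)" if "\<gamma> \<in> \<Gamma>" for \<gamma>
    using cg[OF that] unfolding p_def by (auto dest: continuous_map_image_subset_topspace)
  have tZ: "topspace (Z \<gamma>) = s \<gamma> ` p \<gamma> ` topspace X" if "\<gamma> \<in> \<Gamma>" for \<gamma>
    using sub[OF that] ps unfolding Z_def topspace_pullback_topology by auto
  have sc: "continuous_map (subtopology (Y \<gamma>) (p \<gamma> ` topspace X)) (Z \<gamma>) (s \<gamma>)" if "\<gamma> \<in> \<Gamma>" for \<gamma>
    unfolding Z_def
  proof (rule continuous_map_pullback')
    show "continuous_map (subtopology (Y \<gamma>) (p \<gamma> ` topspace X))
            (subtopology (Y \<gamma>) (p \<gamma> ` topspace X)) (p \<gamma> \<circ> s \<gamma>)"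
      by (rule continuous_map_eq[OF continuous_map_id]) (auto simp: ps)
  qed auto
  have hom: "subtopology (Y \<gamma>) (p \<gamma> ` topspace X) homeomorphic_space Z \<gamma>" if "\<gamma> \<in> \<Gamma>" for \<gamma>
  proof -
    have "continuous_map (Z \<gamma>) (subtopology (Y \<gamma>) (p \<gamma> ` topspace X)) (p \<gamma>)"
      using continuous_map_pullback[OF continuous_map_id] unfolding Z_def by fastforce
    then have "homeomorphic_maps (subtopology (Y \<gamma>) (p \<gamma> ` topspace X)) (Z \<gamma>) (s \<gamma>) (p \<gamma>)"
      using sc[OF that] tZ[OF that] ps by (auto simp: homeomorphic_maps_def)
    then show ?thesis unfolding homeomorphic_space_def by blast
  qed
  have mZ: "metrizable_space (Z \<gamma>)" if "\<gamma> \<in> \<Gamma>" for \<gamma>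
    using hom[OF that] Y(2)[OF that] homeomorphic_metrizable_space metrizable_space_subtopology
    by blast
  have kZ: "compact_space (Z \<gamma>)" if "\<gamma> \<in> \<Gamma>" for \<gamma>
  proof -
    have "compactin (Y \<gamma>) (p \<gamma> ` topspace X)"
      using image_compactin[OF _ cg[OF that]] X unfolding p_def compact_space_def by blast
    then show ?thesis
      using hom[OF that] homeomorphic_compact_space compact_space_subtopology by blast
  qed
  have cZ: "c \<gamma> \<in> topspace (Z \<gamma>)" if "\<gamma> \<in> \<Gamma>" for \<gamma>
    using x0 unfolding tZ[OF that] c_def by auto
  have "continuous_map X (Z (sel q)) (\<lambda>x. g x q)" if q: "q \<in> \<Delta>" for q
  proof -
    have "continuous_map X (subtopology (Y (sel q)) (p (sel q) ` topspace X)) (p (sel q))"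
      using cg[OF sel\<Gamma>[OF q]] unfolding p_def continuous_map_in_subtopology by auto
    from continuous_map_compose[OF this sc[OF sel\<Gamma>[OF q]]] show ?thesis
      using q by (simp add: g_def o_def)
  qed
  then have gc: "continuous_map X (product_topology (Z \<circ> sel) \<Delta>) g"
    unfolding continuous_map_componentwise by (auto simp: g_def)
  have gfin: "finite {q \<in> \<Delta>. g x q \<noteq> (c \<circ> sel) q}" if x: "x \<in> topspace X" for x
  proof (rule finite_subset[OF _ finite_vimage_IntI[OF fin[OF x] \<Delta>(2)]])
    show "{q \<in> \<Delta>. g x q \<noteq> (c \<circ> sel) q} \<subseteq> sel -` {\<gamma> \<in> \<Gamma>. f x \<gamma> \<noteq> b \<gamma>} \<inter> \<Delta>"
    proof (rule subsetI)
      fix q assume "q \<in> {q \<in> \<Delta>. g x q \<noteq> (c \<circ> sel) q}"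
      then have q: "q \<in> \<Delta>" and ne: "g x q \<noteq> (c \<circ> sel) q" by auto
      have "f x (sel q) \<noteq> b (sel q)"
      proof
        assume eq: "f x (sel q) = b (sel q)"
        then have "b (sel q) \<in> p (sel q) ` topspace X"
          using x unfolding p_def by (metis imageI)
        then have "c (sel q) = s (sel q) (b (sel q))"
          by (simp add: c_def)
        then show False
          using ne q eq by (simp add: g_def p_def)
      qed
      then show "q \<in> sel -` {\<gamma> \<in> \<Gamma>. f x \<gamma> \<noteq> b \<gamma>} \<inter> \<Delta>"
        using q sel\<Gamma> by auto
    qed
  qed
  have ginj: "inj_on g (topspace X)"
  proof (rule inj_onI, rule ccontr)
    fix x y assume x: "x \<in> topspace X" and y: "y \<in> topspace X" and eq: "g x = g y" and ne: "x \<noteq> y"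
    then have D: "(x, y) \<in> D" by (simp add: D_def)
    then obtain q where q: "q \<in> \<Delta>" "sel q = sel (x, y)"
      using \<Delta>(3) by (metis imageE imageI)
    have "s (sel q) (p (sel q) x) = s (sel q) (p (sel q) y)"
      using fun_cong[OF eq, of q] q by (simp add: g_def)
    then have "p (sel q) x = p (sel q) y"
      using ps x y by (metis imageI)
    then show False using sel[OF D] q(2) by (simp add: p_def)
  qed
  have "embedding_map X (sigma_product (Z \<circ> sel) (c \<circ> sel) \<Delta>) g"
  proof (rule continuous_imp_embedding_map)
    show "continuous_map X (sigma_product (Z \<circ> sel) (c \<circ> sel) \<Delta>) g"
      unfolding sigma_product_def continuous_map_in_subtopology using gc gfin by auto
    show "Hausdorff_space (sigma_product (Z \<circ> sel) (c \<circ> sel) \<Delta>)"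
      using mZ sel\<Gamma> by (intro Hausdorff_space_sigma_product) auto
  qed (use X ginj in auto)
  moreover have "\<forall>q\<in>\<Delta>. compact_space ((Z \<circ> sel) q) \<and> metrizable_space ((Z \<circ> sel) q) \<and>
      (c \<circ> sel) q \<in> topspace ((Z \<circ> sel) q)"
    using mZ kZ cZ sel\<Gamma> by auto
  ultimately show ?thesis
    unfolding NY_compact_def using X by blast
qed

subsection \<open>The space of Radon probability measures\<close>

definition radon_prob_measures :: "'k topology \<Rightarrow> 'k measure set" where
  "radon_prob_measures K = {M.
     space M = topspace K \<and> sets M = sigma_sets (topspace K) {U. openin K U} \<and> prob_space M \<and>
     (\<forall>A\<in>sets M. emeasure M A = (SUP C\<in>{C. C \<subseteq> A \<and> compactin K C \<and> C \<in> sets M}. emeasure M C) \<and>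
                 emeasure M A = (INF U\<in>{U. A \<subseteq> U \<and> openin K U}. emeasure M U))}"

(* The weak* topology of C(K)^* is that of pointwise convergence on C(K), i.e. it is inherited
   from the product of copies of the real line indexed by C(K); a measure is identified with the
   functional integrating against it.  Values of f outside topspace K are irrelevant. *)
definition prob_measure_space :: "'k topology \<Rightarrow> 'k measure topology" where
  "prob_measure_space K =
     pullback_topology (radon_prob_measures K)
       (\<lambda>M. \<lambda>f\<in>{f. continuous_map K euclideanreal f}. \<integral>x. f x \<partial>M)
       (product_topology (\<lambda>f. euclideanreal) {f. continuous_map K euclideanreal f})"

lemma topspace_prob_measure_space [simp]:
  "topspace (prob_measure_space K) = radon_prob_measures K"
  by (auto simp: prob_measure_space_def topspace_pullback_topology)

end

theory Submission
  imports Defs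
begin

text \<open>A nonempty NY compact space has a nonempty open set on which finitely many coordinates separate
  points (Baire).  If the space is convex, or is \<open>P(K)\<close>, the maps \<open>y \<mapsto> (1 - t) x + t y\<close> with \<open>x\<close> in
  that open set and \<open>t > 0\<close> small embed the whole space into it, so the space is metrizable; and \<open>K\<close>
  embeds into \<open>P(K)\<close> by Dirac measures.

  Conversely, let \<open>K\<close> be compact metrizable.  Coding the points of \<open>K\<close> by reals in a Borel way, with
  a continuous decoding on a compact set, turns Helly's selection theorem into sequential
  compactness of \<open>P(K)\<close>.  Countably many integrals determine a measure, and a subsequence argument
  shows that they embed \<open>P(K)\<close> as a compact set of real sequences.\<close>

section \<open>Metrizable pieces of NY compact spaces\<close>

text \<open>Part (2) is not an instance of part (1): the type \<open>measure\<close> is not a vector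
  space, so \<open>P(K)\<close> is not literally a convex subset of one. The contraction argument is
  therefore stated for an abstract family \<open>c t x y\<close> and applied once to affine
  combinations and once to \<open>mix_measure\<close>. It rests on joint continuity in
  \<open>(t, y)\<close>, constancy at \<open>t = 0\<close> and injectivity for \<open>t > 0\<close>.
  A single \<open>t\<close> has to move all points \<open>y\<close> into the open piece at the same
  time; compactness of the whole space provides it. In the converse, Helly's theorem concerns the
  line, and a compact metrizable space such as a square has no continuous injection into the line. A
  merely Borel code removes this obstacle, but weak convergence of the coded measures only tests
  continuous functions. Hence the decoding has to be continuous on a compact set of codes that
  carries all these measures and their limit.\<close>

lemma NY_compact_imp_Hausdorff_space:
  fixes X :: "'a topology"
  assumes "NY_compact X"
  shows "Hausdorff_space X"
proof -
  obtain \<Gamma> :: "('a \<times> 'a) set" and Y :: "'a \<times> 'a \<Rightarrow> 'a topology" and b f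
    where Y: "\<forall>\<gamma>\<in>\<Gamma>. compact_space (Y \<gamma>) \<and> metrizable_space (Y \<gamma>) \<and> b \<gamma> \<in> topspace (Y \<gamma>)"
      and f: "embedding_map X (sigma_product Y b \<Gamma>) f"
    using assms unfolding NY_compact_def by blast
  have "Hausdorff_space (sigma_product Y b \<Gamma>)"
    using Y by (intro Hausdorff_space_sigma_product) auto
  then show ?thesis
    using homeomorphic_Hausdorff_space[OF embedding_map_imp_homeomorphic_space[OF f]]
      Hausdorff_space_subtopology by blast
qed

text \<open>A continuous injection of a compact space into a Hausdorff space is an embedding, so
  metrizability can be pulled back without examining the inverse map.\<close>

lemma continuous_injective_into_metrizable:
  assumes "compact_space X" "metrizable_space Z" "continuous_map X Z g" "inj_on g (topspace X)"
  shows "metrizable_space X"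
proof -
  have "embedding_map X Z g"
    using assms by (intro continuous_imp_embedding_map) (auto intro: metrizable_imp_Hausdorff_space)
  from homeomorphic_metrizable_space[OF embedding_map_imp_homeomorphic_space[OF this]]
  show ?thesis using metrizable_space_subtopology[OF assms(2)] by blast
qed

text \<open>By Baire, the points whose support has size at most some \<open>n\<close> have nonempty interior.  Near an
  interior point of maximal support all supports coincide, so finitely many coordinates separate.\<close>

lemma NY_compact_open_subset_into_metrizable:
  fixes X :: "'a topology"
  assumes X: "NY_compact X" and ne: "topspace X \<noteq> {}"
  obtains V g and Z :: "('a \<times> 'a \<Rightarrow> 'a) topology"
    where "openin X V" "V \<noteq> {}" "metrizable_space Z"
      "continuous_map (subtopology X V) Z g" "inj_on g V"
proof -
  obtain \<Gamma> :: "('a \<times> 'a) set" and Y :: "'a \<times> 'a \<Rightarrow> 'a topology" and b f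
    where Y: "\<And>\<gamma>. \<gamma> \<in> \<Gamma> \<Longrightarrow> metrizable_space (Y \<gamma>)" "\<And>\<gamma>. \<gamma> \<in> \<Gamma> \<Longrightarrow> b \<gamma> \<in> topspace (Y \<gamma>)"
      and f: "embedding_map X (sigma_product Y b \<Gamma>) f"
    using X unfolding NY_compact_def by blast
  have "continuous_map X (sigma_product Y b \<Gamma>) f"
    using f unfolding embedding_map_def
    by (meson continuous_map_in_subtopology homeomorphic_imp_continuous_map)
  then have cf: "continuous_map X (product_topology Y \<Gamma>) f"
    and fin: "\<And>x. x \<in> topspace X \<Longrightarrow> finite {\<gamma> \<in> \<Gamma>. f x \<gamma> \<noteq> b \<gamma>}"
    unfolding sigma_product_def continuous_map_in_subtopology by auto
  have inj: "inj_on f (topspace X)"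
    using f unfolding embedding_map_def using homeomorphic_imp_injective_map by blast
  have ext: "f x \<in> extensional \<Gamma>" if "x \<in> topspace X" for x
    using cf that unfolding continuous_map_componentwise by blast
  have cg: "continuous_map X (Y \<gamma>) (\<lambda>x. f x \<gamma>)" if "\<gamma> \<in> \<Gamma>" for \<gamma>
    using cf that unfolding continuous_map_componentwise by blast
  define supp where "supp x = {\<gamma> \<in> \<Gamma>. f x \<gamma> \<noteq> b \<gamma>}" for x
  have fin: "finite (supp x)" if "x \<in> topspace X" for x
    using fin[OF that] by (simp add: supp_def)
  have op1: "openin X {x \<in> topspace X. f x \<gamma> \<noteq> b \<gamma>}" if "\<gamma> \<in> \<Gamma>" for \<gamma>
  proof -
    have Yg: "Hausdorff_space (Y \<gamma>)" "b \<gamma> \<in> topspace (Y \<gamma>)"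
      using Y[OF that] by (auto intro: metrizable_imp_Hausdorff_space)
    have "openin (Y \<gamma>) (topspace (Y \<gamma>) - {b \<gamma>})"
      by (rule openin_diff[OF openin_topspace closedin_Hausdorff_singleton[OF Yg]])
    from openin_continuous_map_preimage[OF cg[OF that] this]
    have "openin X {x \<in> topspace X. f x \<gamma> \<in> topspace (Y \<gamma>) - {b \<gamma>}}" .
    moreover have "{x \<in> topspace X. f x \<gamma> \<in> topspace (Y \<gamma>) - {b \<gamma>}}
        = {x \<in> topspace X. f x \<gamma> \<noteq> b \<gamma>}"
      using continuous_map_image_subset_topspace[OF cg[OF that]] by auto
    ultimately show ?thesis by simp
  qed
  have op2: "openin X {x \<in> topspace X. F \<subseteq> supp x}" if "finite F" "F \<subseteq> \<Gamma>" for F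
  proof -
    have "{x \<in> topspace X. F \<subseteq> supp x} = topspace X \<inter> \<Inter> ((\<lambda>\<gamma>. {x \<in> topspace X. f x \<gamma> \<noteq> b \<gamma>}) ` F)"
      using that(2) by (auto simp: supp_def)
    moreover have "openin X (topspace X \<inter> \<Inter> ((\<lambda>\<gamma>. {x \<in> topspace X. f x \<gamma> \<noteq> b \<gamma>}) ` F))"
      using that op1 by (cases "F = {}") (auto intro!: openin_Int openin_Inter)
    ultimately show ?thesis by simp
  qed
  define K where "K n = {x \<in> topspace X. card (supp x) \<le> n}" for n :: nat
  have clK: "closedin X (K n)" for n
  proof -
    \<comment> \<open>Supports are finite, so a support with more than \<open>n\<close> elements is
      itself a witness \<open>F\<close>; each set in the union is open by
      \<open>op2\<close>.\<close>
    have "topspace X - K n = \<Union> ((\<lambda>F. {x \<in> topspace X. F \<subseteq> supp x}) ` {F. finite F \<and> F \<subseteq> \<Gamma> \<and> card F > n})"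
    proof (intro equalityI subsetI)
      fix x assume x: "x \<in> topspace X - K n"
      then have "supp x \<in> {F. finite F \<and> F \<subseteq> \<Gamma> \<and> card F > n}"
        using fin by (auto simp: K_def supp_def)
      then show "x \<in> \<Union> ((\<lambda>F. {x \<in> topspace X. F \<subseteq> supp x}) ` {F. finite F \<and> F \<subseteq> \<Gamma> \<and> card F > n})"
        using x by blast
    next
      fix x assume "x \<in> \<Union> ((\<lambda>F. {x \<in> topspace X. F \<subseteq> supp x}) ` {F. finite F \<and> F \<subseteq> \<Gamma> \<and> card F > n})"
      then obtain F where "x \<in> topspace X" "F \<subseteq> supp x" "card F > n" by blast
      then show "x \<in> topspace X - K n"
        using card_mono[OF fin, of x F] by (auto simp: K_def)
    qed
    moreover have "openin X \<dots>"
      using op2 by (intro openin_Union) auto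
    ultimately show ?thesis
      by (auto simp: closedin_def K_def)
  qed
  have "\<exists>n. X interior_of (K n) \<noteq> {}"
  proof (rule ccontr)
    assume "\<not> (\<exists>n. X interior_of (K n) \<noteq> {})"
    then have "X interior_of (\<Union> (range K)) = {}"
      using X clK NY_compact_imp_Hausdorff_space[OF X]
      by (intro Baire_category_alt)
         (auto simp: NY_compact_def compact_imp_locally_compact_space compact_Hausdorff_imp_regular_space)
    moreover have "\<Union> (range K) = topspace X"
      by (auto simp: K_def)
    ultimately show False
      using ne by simp
  qed
  then obtain n where n: "X interior_of (K n) \<noteq> {}" by blast
  define U where "U = X interior_of (K n)"
  have U: "openin X U" "U \<noteq> {}" "U \<subseteq> K n"
    using n interior_of_subset[of X "K n"] by (auto simp: U_def)
  obtain x where x: "x \<in> U" and max: "\<And>y. y \<in> U \<Longrightarrow> card (supp y) \<le> card (supp x)"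
    using U(2,3) ex_has_greatest_nat[of "\<lambda>x. x \<in> U" _ "\<lambda>x. card (supp x)" n]
    by (fastforce simp: K_def)
  have xX: "x \<in> topspace X" using x U(1) openin_subset by blast
  define F where "F = supp x"
  have F: "finite F" "F \<subseteq> \<Gamma>" using fin[OF xX] by (auto simp: F_def supp_def)
  define V where "V = U \<inter> {y \<in> topspace X. F \<subseteq> supp y}"
  have V: "openin X V" "V \<noteq> {}" using U op2[OF F] x xX by (auto simp: V_def F_def)
  \<comment> \<open>Membership in \<open>V\<close> only gives \<open>F \<subseteq> supp y\<close>;
    maximality of \<open>card F\<close> on \<open>U\<close> excludes further elements.\<close>
  have suppV: "supp y = F" if "y \<in> V" for y
    using that max[of y] fin[of y] card_seteq[of "supp y" F] by (auto simp: V_def F_def)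
  define g where "g = (\<lambda>y. restrict (f y) F)"
  have "metrizable_space (product_topology Y F)"
    using F Y by (auto simp: metrizable_space_product_topology intro!: countable_finite)
  moreover have "continuous_map (subtopology X V) (product_topology Y F) g"
    unfolding continuous_map_componentwise g_def
    using F cg by (auto intro!: continuous_map_from_subtopology)
  moreover have "inj_on g V"
  proof (rule inj_onI)
    fix y z assume yz: "y \<in> V" "z \<in> V" "g y = g z"
    then have yzX: "y \<in> topspace X" "z \<in> topspace X" by (auto simp: V_def)
    \<comment> \<open>Outside \<open>F\<close> both points have the base coordinate
      \<open>b \<gamma>\<close>, so only the finitely many coordinates in \<open>F\<close> can
      differ.\<close>
    have "f y \<gamma> = f z \<gamma>" if "\<gamma> \<in> \<Gamma>" for \<gamma>
    proof (cases "\<gamma> \<in> F")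
      case True
      then show ?thesis using fun_cong[OF yz(3), of \<gamma>] by (simp add: g_def)
    next
      case False
      then have "\<gamma> \<notin> supp y" "\<gamma> \<notin> supp z"
        by (simp_all only: suppV[OF yz(1)] suppV[OF yz(2)] not_False_eq_True)
      then show ?thesis using that by (simp add: supp_def)
    qed
    then have "f y = f z"
      using extensionalityI[OF ext[OF yzX(1)] ext[OF yzX(2)]] by blast
    then show "y = z" by (rule inj_onD[OF inj _ yzX])
  qed
  ultimately show thesis by (rule that[OF V])
qed

text \<open>The whole space contracts injectively into the metrizable open piece.\<close>

lemma NY_compact_contractible_imp_metrizable:
  fixes X :: "'a topology" and c :: "real \<Rightarrow> 'a \<Rightarrow> 'a \<Rightarrow> 'a"
  assumes X: "NY_compact X"
    and cont: "\<And>x. x \<in> topspace X \<Longrightarrow>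
      continuous_map (prod_topology (top_of_set {0..1}) X) X (\<lambda>(t, y). c t x y)"
    and c0: "\<And>x y. x \<in> topspace X \<Longrightarrow> y \<in> topspace X \<Longrightarrow> c 0 x y = x"
    and inj: "\<And>t x. 0 < t \<Longrightarrow> t \<le> 1 \<Longrightarrow> x \<in> topspace X \<Longrightarrow> inj_on (c t x) (topspace X)"
  shows "metrizable_space X"
proof (cases "topspace X = {}")
  case True
  then have "X = trivial_topology" by simp
  then show ?thesis using empty_metrizable_space by simp
next
  case False
  obtain V g and Z :: "('a \<times> 'a \<Rightarrow> 'a) topology"
    where V: "openin X V" "V \<noteq> {}" and Z: "metrizable_space Z"
      and g: "continuous_map (subtopology X V) Z g" "inj_on g V"
    by (rule NY_compact_open_subset_into_metrizable[OF X False])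
  obtain x where x: "x \<in> V" using V by blast
  have xX: "x \<in> topspace X" using x V openin_subset by blast
  have kX: "compactin X (topspace X)" using X by (simp add: NY_compact_def compact_space_def)
  let ?I = "top_of_set {0..1::real}"
  have "openin (prod_topology ?I X) {p \<in> topspace (prod_topology ?I X). (case p of (t, y) \<Rightarrow> c t x y) \<in> V}"
    by (rule openin_continuous_map_preimage[OF cont[OF xX] V(1)])
  \<comment> \<open>The preimage of \<open>V\<close> contains the slice over \<open>t = 0\<close>,
    where \<open>c 0 x\<close> is constantly \<open>x\<close>. Compactness thickens the slice to a
    tube over a neighbourhood \<open>T\<close> of 0, uniformly in \<open>y\<close>.\<close>
  from tube_lemma_right[OF this kX, of 0]
  obtain T where T: "openin ?I T" "0 \<in> T" and TV: "\<And>t y. t \<in> T \<Longrightarrow> y \<in> topspace X \<Longrightarrow> c t x y \<in> V"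
    using c0[OF xX] x by fastforce
  obtain e where e: "e > 0" "\<And>t. t \<in> {0..1} \<Longrightarrow> dist t 0 < e \<Longrightarrow> t \<in> T"
    using T unfolding openin_euclidean_subtopology_iff by metis
  \<comment> \<open>Halving \<open>e\<close> makes the distance to 0 strictly smaller than
    \<open>e\<close>; the minimum keeps \<open>t\<close> in the unit interval.\<close>
  define t where "t = min 1 (e / 2)"
  have t: "0 < t" "t \<le> 1" "t \<in> T"
    using e(1) by (auto simp: t_def dist_real_def intro!: e(2))
  have "continuous_map X (prod_topology ?I X) (\<lambda>y. (t, y))"
    using t by (auto simp: continuous_map_pairwise o_def)
  from continuous_map_compose[OF this cont[OF xX]]
  have "continuous_map X X (c t x)"
    by (simp add: o_def)
  then have "continuous_map X (subtopology X V) (c t x)"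
    using TV[OF t(3)] by (auto simp: continuous_map_in_subtopology)
  from continuous_map_compose[OF this g(1)] have "continuous_map X Z (g \<circ> c t x)" .
  moreover have "inj_on (g \<circ> c t x) (topspace X)"
    by (rule comp_inj_on[OF inj[OF t(1,2) xX] inj_on_subset[OF g(2)]]) (use TV[OF t(3)] in auto)
  moreover have "compact_space X"
    using X by (simp add: NY_compact_def)
  ultimately show ?thesis
    using continuous_injective_into_metrizable[OF _ Z] by blast
qed

text \<open>Moving along segments from \<open>x\<close> is jointly continuous by continuity of the
  vector operations, stays in \<open>C\<close> by convexity, and is injective in the far endpoint
  because \<open>t > 0\<close> can be cancelled.\<close>

lemma convex_NY_compact_imp_metrizable:
  fixes E :: "'e::real_vector topology"
  assumes E: "topological_vector_space E" and C: "convex C" and NY: "NY_compact (subtopology E C)"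
  shows "metrizable_space (subtopology E C)"
proof (rule NY_compact_contractible_imp_metrizable[OF NY, where c = "\<lambda>t x y. (1 - t) *\<^sub>R x + t *\<^sub>R y"])
  have UE: "topspace E = UNIV"
    and add: "continuous_map (prod_topology E E) E (\<lambda>(x, y). x + y)"
    and scale: "continuous_map (prod_topology euclideanreal E) E (\<lambda>(t, x). t *\<^sub>R x)"
    using E by (auto simp: topological_vector_space_def)
  fix x assume x: "x \<in> topspace (subtopology E C)"
  let ?P = "prod_topology (top_of_set {0..1::real}) (subtopology E C)"
  have fst: "continuous_map ?P euclideanreal fst"
    using continuous_map_fst[of "top_of_set {0..1::real}" "subtopology E C"]
    by (simp add: continuous_map_in_subtopology)
  have snd: "continuous_map ?P E snd"
    using continuous_map_snd[of "top_of_set {0..1::real}" "subtopology E C"]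
    by (simp add: continuous_map_in_subtopology)
  have s: "continuous_map ?P E (\<lambda>p. s p *\<^sub>R v p)"
    if "continuous_map ?P euclideanreal s" "continuous_map ?P E v" for s v
    using continuous_map_compose[OF _ scale, of ?P "\<lambda>p. (s p, v p)"] that
    by (simp add: continuous_map_pairwise o_def)
  have "continuous_map ?P E (\<lambda>p. (1 - fst p) *\<^sub>R x)"
    using fst UE by (intro s) (auto intro!: continuous_intros)
  moreover have "continuous_map ?P E (\<lambda>p. fst p *\<^sub>R snd p)"
    using fst snd by (intro s)
  ultimately have "continuous_map ?P E (\<lambda>p. (1 - fst p) *\<^sub>R x + fst p *\<^sub>R snd p)"
    using continuous_map_compose[OF _ add, of ?P "\<lambda>p. ((1 - fst p) *\<^sub>R x, fst p *\<^sub>R snd p)"]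
    by (simp add: continuous_map_pairwise o_def)
  then show "continuous_map ?P (subtopology E C) (\<lambda>(t, y). (1 - t) *\<^sub>R x + t *\<^sub>R y)"
    using x convexD_alt[OF C] unfolding continuous_map_in_subtopology case_prod_unfold
    by (auto simp only: UE topspace_prod_topology topspace_subtopology topspace_euclidean fst_conv
        snd_conv Int_iff atLeastAtMost_iff mem_Times_iff image_subset_iff Pi_iff)
next
  fix t :: real and x assume "0 < t"
  then show "inj_on (\<lambda>y. (1 - t) *\<^sub>R x + t *\<^sub>R y) (topspace (subtopology E C))"
    by (simp add: inj_on_def)
qed simp

section \<open>Convexity of the space of Radon probability measures\<close>

text \<open>For a finite measure, inner and outer regularity together say that \<open>A\<close> is
  squeezed between a compact and an open set with a small gap. This form replaces suprema and infima
  by one inequality, which passes easily to mixtures and to image measures.\<close>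

lemma radon_prob_measures_iff:
  "M \<in> radon_prob_measures K \<longleftrightarrow>
     space M = topspace K \<and> sets M = sigma_sets (topspace K) {U. openin K U} \<and> prob_space M \<and>
     (\<forall>A\<in>sets M. \<forall>e>0. \<exists>C U. compactin K C \<and> C \<in> sets M \<and> openin K U \<and> C \<subseteq> A \<and> A \<subseteq> U \<and>
        measure M (U - C) < e)" (is "?L \<longleftrightarrow> ?R")
proof
  assume L: ?L
  then have S: "space M = topspace K" "sets M = sigma_sets (topspace K) {U. openin K U}"
    and P: "prob_space M"
    and inner: "\<And>A. A \<in> sets M \<Longrightarrow>
      emeasure M A = (SUP C\<in>{C. C \<subseteq> A \<and> compactin K C \<and> C \<in> sets M}. emeasure M C)"
    and outer: "\<And>A. A \<in> sets M \<Longrightarrow> emeasure M A = (INF U\<in>{U. A \<subseteq> U \<and> openin K U}. emeasure M U)"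
    using L unfolding radon_prob_measures_def mem_Collect_eq by blast+
  interpret prob_space M by fact
  have op: "U \<in> sets M" if "openin K U" for U
    using that by (auto simp: S)
  have "\<exists>C U. compactin K C \<and> C \<in> sets M \<and> openin K U \<and> C \<subseteq> A \<and> A \<subseteq> U \<and> measure M (U - C) < e"
    if A: "A \<in> sets M" and e: "e > 0" for A e
  proof -
    have "\<exists>C. C \<subseteq> A \<and> compactin K C \<and> C \<in> sets M \<and> measure M A - e / 2 < measure M C"
    proof (rule ccontr)
      assume neg: "\<not> ?thesis"
      \<comment> \<open>The empty compact set shows that the real bound is nonnegative. Otherwise
        \<open>ennreal\<close> would truncate it to 0 and the next inequality would not yield a
        contradiction.\<close>
      have "measure M {} \<le> measure M A - e / 2"
        using neg by (metis compactin_empty empty_subsetI not_le sets.empty_sets)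
      then have "0 \<le> measure M A - e / 2" by simp
      moreover have "emeasure M A \<le> ennreal (measure M A - e / 2)"
        unfolding inner[OF A]
        by (rule SUP_least) (use neg in \<open>auto simp: emeasure_eq_measure not_less intro!: ennreal_leI\<close>)
      ultimately show False
        using e by (simp add: emeasure_eq_measure)
    qed
    then obtain C where C: "C \<subseteq> A" "compactin K C" "C \<in> sets M" "measure M A - e / 2 < measure M C"
      by blast
    have "\<exists>U. A \<subseteq> U \<and> openin K U \<and> measure M U < measure M A + e / 2"
    proof (rule ccontr)
      assume neg: "\<not> ?thesis"
      have "ennreal (measure M A + e / 2) \<le> emeasure M A"
        unfolding outer[OF A]
        by (rule INF_greatest) (use neg in \<open>auto simp: emeasure_eq_measure not_less intro!: ennreal_leI\<close>)
      then show False
        using e by (simp add: emeasure_eq_measure)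
    qed
    then obtain U where U: "A \<subseteq> U" "openin K U" "measure M U < measure M A + e / 2"
      by blast
    have "measure M (U - C) = measure M U - measure M C"
      using C U op by (intro finite_measure_Diff) auto
    also have "\<dots> < e" using C(4) U(3) by (simp add: field_simps)
    finally show ?thesis using C U by blast
  qed
  then show ?R using S P by blast
next
  assume R: ?R
  note S = conjunct1[OF R] conjunct1[OF conjunct2[OF R]]
    and P = conjunct1[OF conjunct2[OF conjunct2[OF R]]]
    and R' = conjunct2[OF conjunct2[OF conjunct2[OF R]]]
  interpret prob_space M by (rule P)
  have op: "U \<in> sets M" if "openin K U" for U
    using that by (auto simp: S)
  have "emeasure M A = (SUP C\<in>{C. C \<subseteq> A \<and> compactin K C \<and> C \<in> sets M}. emeasure M C) \<and>
     emeasure M A = (INF U\<in>{U. A \<subseteq> U \<and> openin K U}. emeasure M U)" if A: "A \<in> sets M" for A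
  proof -
    have ap: "\<exists>C U. compactin K C \<and> C \<in> sets M \<and> openin K U \<and> C \<subseteq> A \<and> A \<subseteq> U \<and>
        measure M A \<le> measure M C + e \<and> measure M U \<le> measure M A + e" if e: "e > 0" for e
    proof -
      obtain C U where CU: "compactin K C" "C \<in> sets M" "openin K U" "C \<subseteq> A" "A \<subseteq> U"
        "measure M (U - C) < e"
        using bspec[OF R' A, rule_format, OF e] by blast
      have "measure M (U - C) = measure M U - measure M C"
        using CU op by (intro finite_measure_Diff) auto
      moreover have "measure M C \<le> measure M A" "measure M A \<le> measure M U"
        using CU op A by (auto intro!: finite_measure_mono)
      ultimately have "measure M A \<le> measure M C + e" "measure M U \<le> measure M A + e"
        using CU(6) by linarith+
      then show ?thesis using CU by blast
    qed
    have "emeasure M A = (SUP C\<in>{C. C \<subseteq> A \<and> compactin K C \<and> C \<in> sets M}. emeasure M C)"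
    proof (rule ennreal_approx_SUP)
      fix e :: real assume e: "0 < e"
      from ap[OF e] show "\<exists>C\<in>{C. C \<subseteq> A \<and> compactin K C \<and> C \<in> sets M}. emeasure M A \<le> emeasure M C + ennreal e"
        using e by (auto simp: emeasure_eq_measure simp flip: ennreal_plus)
    qed (use A in \<open>auto intro: emeasure_mono\<close>)
    moreover have "emeasure M A = (INF U\<in>{U. A \<subseteq> U \<and> openin K U}. emeasure M U)"
    proof (rule ennreal_approx_INF)
      fix e :: real assume e: "0 < e"
      from ap[OF e] show "\<exists>U\<in>{U. A \<subseteq> U \<and> openin K U}. emeasure M U \<le> emeasure M A + ennreal e"
        using e by (auto simp: emeasure_eq_measure simp flip: ennreal_plus)
    qed (use op in \<open>auto intro: emeasure_mono\<close>)
    ultimately show ?thesis by blast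
  qed
  then show ?L using S P unfolding radon_prob_measures_def mem_Collect_eq by blast
qed

lemma radon_prob_measuresD:
  assumes "M \<in> radon_prob_measures K"
  shows "space M = topspace K" "sets M = sigma_sets (topspace K) {U. openin K U}" "prob_space M"
  using assms unfolding radon_prob_measures_def mem_Collect_eq by blast+

lemma borel_measurable_if_continuous_map:
  assumes "space M = topspace K" "sets M = sigma_sets (topspace K) {U. openin K U}"
    and "continuous_map K euclidean f"
  shows "f \<in> borel_measurable M"
proof (rule borel_measurableI)
  fix S :: "'b set" assume "open S"
  then have "openin K {x \<in> topspace K. f x \<in> S}"
    using assms(3) by (intro openin_continuous_map_preimage) auto
  moreover have "f -` S \<inter> space M = {x \<in> topspace K. f x \<in> S}" using assms(1) by auto
  ultimately show "f -` S \<inter> space M \<in> sets M"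
    using assms(2) by auto
qed

lemma compact_space_continuous_map_bounded:
  assumes "compact_space K" "continuous_map K euclideanreal f"
  obtains B where "\<And>x. x \<in> topspace K \<Longrightarrow> \<bar>f x\<bar> \<le> B"
proof -
  have "compactin euclideanreal (f ` topspace K)"
    using image_compactin[OF _ assms(2)] assms(1) unfolding compact_space_def by blast
  then have "bounded (f ` topspace K)" by (simp add: compact_imp_bounded)
  then show thesis using that by (auto simp: bounded_iff)
qed

text \<open>The weak* topology is the initial topology for the integrals, so continuity may be
  tested one integrand at a time.\<close>

lemma continuous_map_into_prob_measure_space:
  assumes "\<phi> \<in> topspace X \<rightarrow> radon_prob_measures K"
    and "\<And>f. continuous_map K euclideanreal f \<Longrightarrow>
      continuous_map X euclideanreal (\<lambda>x. \<integral>y. f y \<partial>\<phi> x)"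
  shows "continuous_map X (prob_measure_space K) \<phi>"
  unfolding prob_measure_space_def
proof (rule continuous_map_pullback')
  show "continuous_map X (product_topology (\<lambda>f. euclideanreal) {f. continuous_map K euclideanreal f})
     ((\<lambda>M. \<lambda>f\<in>{f. continuous_map K euclideanreal f}. \<integral>x. f x \<partial>M) \<circ> \<phi>)"
    unfolding continuous_map_componentwise using assms(2) by auto
qed (use assms(1) in auto)

lemma continuous_map_prob_measure_space_integral:
  assumes "continuous_map K euclideanreal f"
  shows "continuous_map (prob_measure_space K) euclideanreal (\<lambda>M. \<integral>y. f y \<partial>M)"
proof -
  have "continuous_map (product_topology (\<lambda>f. euclideanreal) {f. continuous_map K euclideanreal f})
      euclideanreal (\<lambda>v. v f)"
    using assms by (intro continuous_map_product_projection) auto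
  from continuous_map_pullback[OF this,
      of "radon_prob_measures K" "\<lambda>M. \<lambda>f\<in>{f. continuous_map K euclideanreal f}. \<integral>x. f x \<partial>M"]
  show ?thesis
    using assms by (simp add: prob_measure_space_def o_def)
qed

text \<open>This is \<open>(1 - t) M + t N\<close>, realized as a two-stage experiment: toss a coin
  of bias \<open>t\<close>, then draw from \<open>N\<close> or \<open>M\<close>. Results on
  \<open>bind\<close> supply the sigma-algebra and the integrals. The weight \<open>t\<close>
  belongs to the second measure so that \<open>t = 0\<close> returns the fixed first one.\<close>

definition mix_measure :: "real \<Rightarrow> 'a measure \<Rightarrow> 'a measure \<Rightarrow> 'a measure" where
  "mix_measure t M N = measure_pmf (bernoulli_pmf t) \<bind> (\<lambda>b. if b then N else M)"

context
  fixes t :: real and M N :: "'a measure"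
  assumes t: "0 \<le> t" "t \<le> 1" and M: "prob_space M" and N: "prob_space N" and sets_eq: "sets N = sets M"
begin

lemma mix_measure_kernel:
  "(\<lambda>b. if b then N else M) \<in> measure_pmf p \<rightarrow>\<^sub>M prob_algebra M"
  using M N sets_eq by (simp add: measurable_pmf_measure1 space_prob_algebra)

lemma sets_mix_measure: "sets (mix_measure t M N) = sets M"
  unfolding mix_measure_def by (rule sets_bind) (simp_all add: sets_eq)

lemma space_mix_measure: "space (mix_measure t M N) = space M"
  using sets_mix_measure by (rule sets_eq_imp_space_eq)

lemma emeasure_mix_measure:
  "emeasure (mix_measure t M N) A = t * emeasure N A + (1 - t) * emeasure M A"
proof (cases "A \<in> sets M")
  case True
  have "emeasure (mix_measure t M N) A =
      (\<integral>\<^sup>+b. emeasure (if b then N else M) A \<partial>measure_pmf (bernoulli_pmf t))"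
    unfolding mix_measure_def
    by (rule emeasure_bind[OF _ measurable_prob_algebraD[OF mix_measure_kernel] True]) simp
  then show ?thesis using t by (simp add: mult.commute)
next
  case False
  then show ?thesis
    using sets_mix_measure sets_eq by (simp add: emeasure_notin_sets)
qed

lemma prob_space_mix_measure: "prob_space (mix_measure t M N)"
proof
  have "emeasure (mix_measure t M N) (space M) = ennreal t * 1 + ennreal (1 - t) * 1"
    using prob_space.emeasure_space_1[OF M] prob_space.emeasure_space_1[OF N]
      sets_eq_imp_space_eq[OF sets_eq] by (simp add: emeasure_mix_measure)
  also have "\<dots> = 1" using t by (simp flip: ennreal_plus)
  finally show "emeasure (mix_measure t M N) (space (mix_measure t M N)) = 1"
    by (simp add: space_mix_measure)
qed

lemma measure_mix_measure:
  "measure (mix_measure t M N) A = t * measure N A + (1 - t) * measure M A"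
proof -
  interpret M: prob_space M by (rule M)
  interpret N: prob_space N by (rule N)
  interpret prob_space "mix_measure t M N" by (rule prob_space_mix_measure)
  have "ennreal (measure (mix_measure t M N) A) = ennreal (t * measure N A + (1 - t) * measure M A)"
    using emeasure_mix_measure[of A] t
    by (simp add: emeasure_eq_measure M.emeasure_eq_measure N.emeasure_eq_measure
        ennreal_mult[symmetric] ennreal_plus[symmetric] del: ennreal_plus)
  then show ?thesis using t by (subst (asm) ennreal_inj) auto
qed

lemma integral_mix_measure:
  fixes f :: "'a \<Rightarrow> real"
  assumes "f \<in> borel_measurable M" and "\<And>x. x \<in> space M \<Longrightarrow> \<bar>f x\<bar> \<le> B"
  shows "integral\<^sup>L (mix_measure t M N) f = t * integral\<^sup>L N f + (1 - t) * integral\<^sup>L M f"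
proof -
  have "integral\<^sup>L (mix_measure t M N) f =
      (\<integral>b. integral\<^sup>L (if b then N else M) f \<partial>measure_pmf (bernoulli_pmf t))"
    unfolding mix_measure_def
    by (rule integral_bind[where B' = 1, OF assms measurable_prob_algebraD[OF mix_measure_kernel]])
       (auto simp: prob_space.emeasure_space_1 M N intro: prob_space.finite_measure prob_space_measure_pmf)
  then show ?thesis using t by simp
qed

end

text \<open>Enlarging the compact set and shrinking the open set improves the approximation for both
  measures. Hence the common pair \<open>C \<union> D\<close>, \<open>U \<inter> V\<close> leaves a
  gap below \<open>e\<close> for \<open>M\<close> and for \<open>N\<close>, and so for their
  average.\<close>

lemma mix_measure_radon:
  assumes "0 \<le> t" "t \<le> 1" and M: "M \<in> radon_prob_measures K" and N: "N \<in> radon_prob_measures K"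
  shows "mix_measure t M N \<in> radon_prob_measures K"
proof -
  note M' = radon_prob_measuresD[OF M] and N' = radon_prob_measuresD[OF N]
  have s: "sets N = sets M" using M' N' by simp
  note mix = assms(1,2) M'(3) N'(3) s
  have op: "U \<in> sets M" if "openin K U" for U
    using that M' by auto
  have "\<exists>C U. compactin K C \<and> C \<in> sets M \<and> openin K U \<and> C \<subseteq> A \<and> A \<subseteq> U \<and>
      measure (mix_measure t M N) (U - C) < e" if A: "A \<in> sets M" and e: "e > 0" for A e
  proof -
    obtain C U where C: "compactin K C" "C \<in> sets M" "C \<subseteq> A" and U: "openin K U" "A \<subseteq> U"
      and CU: "measure M (U - C) < e"
      using M A e unfolding radon_prob_measures_iff by blast
    obtain D V where D: "compactin K D" "D \<in> sets M" "D \<subseteq> A" and V: "openin K V" "A \<subseteq> V"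
      and DV: "measure N (V - D) < e"
      using N A e s unfolding radon_prob_measures_iff by blast
    have "measure M (U \<inter> V - (C \<union> D)) \<le> measure M (U - C)"
      using op C D U V M'(3)
      by (intro finite_measure.finite_measure_mono) (auto intro: prob_space.finite_measure)
    moreover have "measure N (U \<inter> V - (C \<union> D)) \<le> measure N (V - D)"
      using op C D U V N'(3) s
      by (intro finite_measure.finite_measure_mono) (auto intro: prob_space.finite_measure)
    ultimately have "measure N (U \<inter> V - (C \<union> D)) < e" "measure M (U \<inter> V - (C \<union> D)) < e"
      using CU DV by auto
    then have "measure (mix_measure t M N) (U \<inter> V - (C \<union> D)) < e"
      unfolding measure_mix_measure[OF mix]
      using assms(1,2) convex_bound_lt[of _ e _ t "1 - t"] by simp
    moreover have "compactin K (C \<union> D)" "openin K (U \<inter> V)"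
      using C D U V by (auto intro: compactin_Un)
    ultimately show ?thesis using C D U V by (intro exI[of _ "C \<union> D"] exI[of _ "U \<inter> V"]) auto
  qed
  then show ?thesis
    unfolding radon_prob_measures_iff[of "mix_measure t M N"] sets_mix_measure[OF mix] space_mix_measure[OF mix]
    using M' prob_space_mix_measure[OF mix] by blast
qed

text \<open>Integrals against a mixture are affine in \<open>t\<close> and in the integrals of its
  components, which gives joint continuity; compactness of \<open>K\<close> bounds the integrands.
  Injectivity follows by cancelling \<open>t > 0\<close> on every measurable set.\<close>

lemma NY_compact_prob_measure_space_imp_metrizable:
  assumes K: "compact_space K" and NY: "NY_compact (prob_measure_space K)"
  shows "metrizable_space (prob_measure_space K)"
proof (rule NY_compact_contractible_imp_metrizable[OF NY, where c = mix_measure];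
    unfold topspace_prob_measure_space)
  fix M N assume M: "M \<in> radon_prob_measures K" and N: "N \<in> radon_prob_measures K"
  note M' = radon_prob_measuresD[OF M] and N' = radon_prob_measuresD[OF N]
  have s: "sets N = sets M" using M' N' by simp
  show "mix_measure 0 M N = M"
    by (rule measure_eqI) (simp_all add: sets_mix_measure emeasure_mix_measure M'(3) N'(3) s)
next
  fix t :: real and M assume t: "0 < t" "t \<le> 1" and M: "M \<in> radon_prob_measures K"
  note M' = radon_prob_measuresD[OF M]
  show "inj_on (mix_measure t M) (radon_prob_measures K)"
  proof (rule inj_onI)
    fix N L assume N: "N \<in> radon_prob_measures K" and L: "L \<in> radon_prob_measures K"
      and eq: "mix_measure t M N = mix_measure t M L"
    note N' = radon_prob_measuresD[OF N] and L' = radon_prob_measuresD[OF L]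
    interpret N: prob_space N by (rule N')
    interpret L: prob_space L by (rule L')
    have "measure N A = measure L A" for A
    proof -
      have "t * measure N A + (1 - t) * measure M A = t * measure L A + (1 - t) * measure M A"
        using arg_cong[OF eq, of "\<lambda>\<mu>. measure \<mu> A"] t M' N' L' by (simp add: measure_mix_measure)
      then show ?thesis using t by simp
    qed
    then show "N = L"
      using N' L' by (intro measure_eqI) (simp_all add: N.emeasure_eq_measure L.emeasure_eq_measure)
  qed
next
  fix M assume M: "M \<in> radon_prob_measures K"
  note M' = radon_prob_measuresD[OF M]
  let ?P = "prod_topology (top_of_set {0..1::real}) (prob_measure_space K)"
  show "continuous_map ?P (prob_measure_space K) (\<lambda>(t, y). mix_measure t M y)"
  proof (rule continuous_map_into_prob_measure_space)
    show "(\<lambda>(t, y). mix_measure t M y) \<in> topspace ?P \<rightarrow> radon_prob_measures K"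
      using M by (auto intro!: mix_measure_radon)
    fix f assume f: "continuous_map K euclideanreal f"
    obtain B where B: "\<And>x. x \<in> topspace K \<Longrightarrow> \<bar>f x\<bar> \<le> B"
      using compact_space_continuous_map_bounded[OF K f] by blast
    have "(\<integral>x. f x \<partial>mix_measure t M N) = t * (\<integral>x. f x \<partial>N) + (1 - t) * (\<integral>x. f x \<partial>M)"
      if "0 \<le> t" "t \<le> 1" "N \<in> radon_prob_measures K" for t N
      using that M' radon_prob_measuresD[OF that(3)] B f
      by (intro integral_mix_measure[where B = B]) (auto intro: borel_measurable_if_continuous_map)
    then have eq: "fst p * (\<integral>x. f x \<partial>snd p) + (1 - fst p) * (\<integral>x. f x \<partial>M) =
        (\<integral>x. f x \<partial>(case p of (t, y) \<Rightarrow> mix_measure t M y))" if "p \<in> topspace ?P" for p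
      using that by (auto simp: case_prod_unfold)
    have 1: "continuous_map ?P euclideanreal fst"
      using continuous_map_fst[of "top_of_set {0..1::real}" "prob_measure_space K"]
      by (simp add: continuous_map_in_subtopology)
    have 2: "continuous_map ?P euclideanreal (\<lambda>p. \<integral>x. f x \<partial>snd p)"
      using continuous_map_compose[OF continuous_map_snd continuous_map_prob_measure_space_integral[OF f]]
      by (simp add: o_def)
    have "continuous_map ?P euclideanreal
        (\<lambda>p. fst p * (\<integral>x. f x \<partial>snd p) + (1 - fst p) * (\<integral>x. f x \<partial>M))"
      by (intro continuous_intros 1 2)
    then show "continuous_map ?P euclideanreal (\<lambda>p. \<integral>x. f x \<partial>(case p of (t, y) \<Rightarrow> mix_measure t M y))"
      by (rule continuous_map_eq) (rule eq)
  qed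
qed

text \<open>Only the position of \<open>x\<close> matters. If \<open>x \<in> A\<close>, the compact
  set \<open>{x}\<close> already has full mass; if not, the complement of \<open>{x}\<close> is an
  open set of mass 0 around \<open>A\<close>. The Hausdorff property makes \<open>{x}\<close>
  closed, hence Borel.\<close>

lemma dirac_radon:
  assumes K: "Hausdorff_space K" and x: "x \<in> topspace K"
  shows "return (sigma (topspace K) {U. openin K U}) x \<in> radon_prob_measures K"
    (is "return ?S x \<in> _")
proof -
  have sub: "{U. openin K U} \<subseteq> Pow (topspace K)" using openin_subset by blast
  have S: "space ?S = topspace K" "sets ?S = sigma_sets (topspace K) {U. openin K U}"
    using sub by auto
  have P: "prob_space (return ?S x)" using x S by (intro prob_space_return) simp
  have o: "openin K (topspace K - {x})"
    by (rule openin_diff[OF openin_topspace closedin_Hausdorff_singleton[OF K x]])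
  have "topspace K - (topspace K - {x}) \<in> sets ?S"
    unfolding S(2) using o by (intro sigma_sets.Compl sigma_sets.Basic) simp
  moreover have "topspace K - (topspace K - {x}) = {x}" using x by blast
  ultimately have sx: "{x} \<in> sets ?S" by simp
  have "\<exists>C U. compactin K C \<and> C \<in> sets ?S \<and> openin K U \<and> C \<subseteq> A \<and> A \<subseteq> U \<and>
      measure (return ?S x) (U - C) < e" if A: "A \<in> sets ?S" and e: "e > 0" for A and e :: real
  proof (cases "x \<in> A")
    case True
    have "topspace K - {x} \<in> sets ?S" using o by (simp only: S(2)) blast
    then have "measure (return ?S x) (topspace K - {x}) < e"
      using e by (simp add: measure_return)
    then show ?thesis
      using True sx x sets.sets_into_space[OF A] S
      by (intro exI[of _ "{x}"] exI[of _ "topspace K"]) auto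
  next
    case False
    have "topspace K - {x} \<in> sets ?S" using o by (simp only: S(2)) blast
    then have "measure (return ?S x) (topspace K - {x} - {}) < e"
      using e by (simp add: measure_return)
    then show ?thesis
      using False o x sets.sets_into_space[OF A] S
      by (intro exI[of _ "{}"] exI[of _ "topspace K - {x}"]) auto
  qed
  then show ?thesis
    unfolding radon_prob_measures_iff using P S by simp
qed

text \<open>Integrating \<open>f\<close> against the Dirac measure at \<open>x\<close> returns
  \<open>f x\<close>, so the Dirac map is continuous. The open set omitting \<open>y\<close>
  distinguishes the measures at \<open>x\<close> and \<open>y\<close>.\<close>

lemma metrizable_prob_measure_space_imp_metrizable:
  fixes K :: "'k topology"
  assumes K: "compact_space K" "Hausdorff_space K" and P: "metrizable_space (prob_measure_space K)"
  shows "metrizable_space K"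
proof (rule continuous_injective_into_metrizable[OF K(1) P])
  let ?S = "sigma (topspace K) {U. openin K U}"
  have sub: "{U. openin K U} \<subseteq> Pow (topspace K)" using openin_subset by blast
  have S: "space ?S = topspace K" "sets ?S = sigma_sets (topspace K) {U. openin K U}"
    using sub by auto
  show "continuous_map K (prob_measure_space K) (return ?S)"
  proof (rule continuous_map_into_prob_measure_space)
    show "return ?S \<in> topspace K \<rightarrow> radon_prob_measures K"
      using dirac_radon[OF K(2)] by blast
    fix f assume f: "continuous_map K euclideanreal f"
    have "f \<in> borel_measurable ?S"
      by (rule borel_measurable_if_continuous_map[OF S f])
    then have "f x = (\<integral>y. f y \<partial>return ?S x)" if "x \<in> topspace K" for x
      using that S by (simp add: integral_return)
    then show "continuous_map K euclideanreal (\<lambda>x. \<integral>y. f y \<partial>return ?S x)"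
      using f by (rule continuous_map_eq[rotated])
  qed
  show "inj_on (return ?S) (topspace K)"
  proof (rule inj_onI, rule ccontr)
    fix x y assume x: "x \<in> topspace K" and y: "y \<in> topspace K"
      and eq: "return ?S x = return ?S y" and ne: "x \<noteq> y"
    have "openin K (topspace K - {y})"
      by (rule openin_diff[OF openin_topspace closedin_Hausdorff_singleton[OF K(2) y]])
    then have "topspace K - {y} \<in> sets ?S" by (simp only: S(2)) blast
    then have "measure (return ?S z) (topspace K - {y}) = indicator (topspace K - {y}) z" for z
      by (simp add: measure_return)
    from this[of x] this[of y] show False
      using eq x ne by simp
  qed
qed

section \<open>Compactness and metrizability of the space of measures\<close>

text \<open>The coordinates are distances to a countable dense set, the union of finite nets. If a
  listed \<open>z\<close> lies within half of \<open>d x y\<close> of \<open>x\<close>, then equal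
  distances from \<open>x\<close> and \<open>y\<close> to \<open>z\<close> contradict the triangle
  inequality.\<close>

lemma compact_metrizable_embeds_in_sequences:
  fixes K :: "'k topology"
  assumes K: "compact_space K" and met: "metrizable_space K"
  obtains h :: "'k \<Rightarrow> nat \<Rightarrow> real" where "continuous_map K euclidean h" "inj_on h (topspace K)"
proof -
  obtain M d where "Metric_space M d" and KM: "K = Metric_space.mtopology M d"
    using met unfolding metrizable_space_def by blast
  then interpret Metric_space M d by simp
  have "mtotally_bounded M"
    using K unfolding KM compact_space_def by (auto intro: compactin_imp_mtotally_bounded)
  then have "\<forall>n::nat. \<exists>F. finite F \<and> F \<subseteq> M \<and> M \<subseteq> (\<Union>x\<in>F. mball x (1 / Suc n))"
    unfolding mtotally_bounded_def by (metis divide_pos_pos of_nat_0_less_iff zero_less_Suc zero_less_one)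
  then obtain F where F: "\<And>n::nat. finite (F n)" "\<And>n. F n \<subseteq> M"
    "\<And>n. M \<subseteq> (\<Union>x\<in>F n. mball x (1 / Suc n))"
    by metis
  define s where "s = from_nat_into (\<Union>n. F n)"
  define h where "h x n = d x (s n)" for x n
  \<comment> \<open>In an empty space the union of the nets is empty and
    \<open>from_nat_into\<close> has no meaningful value, so that case is treated apart.\<close>
  have sM: "s n \<in> M" if "M \<noteq> {}" for n
  proof -
    have "(\<Union>n. F n) \<noteq> {}" using that F(3)[of 0] by blast
    then show ?thesis using F(2) from_nat_into[of "\<Union>n. F n" n] unfolding s_def by blast
  qed
  have "continuous_map K euclideanreal (\<lambda>x. h x n)" for n
  proof (cases "M = {}")
    case True
    then have "topspace K = {}" unfolding KM topspace_mtopology .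
    then show ?thesis by (simp add: continuous_map_on_empty)
  next
    case False
    have "continuous_map mtopology euclideanreal (\<lambda>x. d x (s n))"
      using continuous_map_mdist[of mtopology Self "\<lambda>x. x" "\<lambda>_. s n"] sM[OF False]
      by (simp add: mtopology_of_def)
    then show ?thesis by (simp add: h_def KM)
  qed
  then have "continuous_map K euclidean h"
    unfolding euclidean_product_topology[symmetric] continuous_map_componentwise_UNIV by blast
  moreover have "inj_on h (topspace K)"
  proof (rule inj_onI, rule ccontr)
    fix x y assume "x \<in> topspace K" "y \<in> topspace K" and eq: "h x = h y" and ne: "x \<noteq> y"
    then have xy: "x \<in> M" "y \<in> M" by (auto simp: KM)
    have "d x y > 0" using xy ne by simp
    then obtain n :: nat where n: "inverse (Suc n) < d x y / 2"
      using reals_Archimedean[of "d x y / 2"] by auto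
    obtain z where z: "z \<in> F n" "x \<in> mball z (1 / Suc n)" using F(3)[of n] xy by blast
    have "countable (\<Union>n. F n)" using F(1) by (simp add: countable_finite)
    then obtain m where m: "s m = z"
      using z(1) from_nat_into_surj[of "\<Union>n. F n" z] unfolding s_def by blast
    have zM: "z \<in> M" and dx: "d z x < d x y / 2"
      using z n F(2) by (auto simp: inverse_eq_divide)
    have "d x z = d y z" using fun_cong[OF eq, of m] m by (simp add: h_def)
    then have "d x y \<le> d z x + d z x"
      using triangle[OF xy(1) zM xy(2)] commute by simp
    then show False using dx by simp
  qed
  ultimately show thesis using that by blast
qed

section \<open>Coding compact sets of sequences by real numbers\<close>

text \<open>On 0-1 sequences this parametrizes a scaled Cantor set. Base 3 is chosen because base 2
  gives some numbers two expansions with digits 0 and 1.\<close>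

definition cantor_sum :: "(nat \<Rightarrow> real) \<Rightarrow> real" where
  "cantor_sum a = (\<Sum>n. a n * (1/3) ^ n)"

lemma cantor_sum_summable:
  assumes "\<And>n. a n \<in> {0..1::real}"
  shows "summable (\<lambda>n. a n * (1/3) ^ n)"
  by (rule summable_comparison_test'[where g = "\<lambda>n. (1/3) ^ n" and N = 0])
     (use assms in \<open>auto simp: abs_mult intro!: mult_left_le_one_le\<close>)

text \<open>The whole sum is at most 3/2, so the part after the leading digit contributes at most
  1/2. That is less than 1, so the leading digit can be read off; removing it and rescaling allows
  induction.\<close>

lemma cantor_sum_inj:
  assumes "\<And>n. a n \<in> {0, 1}" "\<And>n. b n \<in> {0, 1}" "cantor_sum a = cantor_sum b"
  shows "a = b"
proof
  have 01: "x \<in> {0..1}" if "x \<in> {0, 1::real}" for x using that by auto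
  have step: "cantor_sum a = a 0 + cantor_sum (\<lambda>n. a (Suc n)) / 3"
    if "\<And>n. a n \<in> {0, 1}" for a
  proof -
    have "cantor_sum a = a 0 + (\<Sum>n. a (Suc n) * (1/3) ^ Suc n)"
      using suminf_split_head[OF cantor_sum_summable[of a]] 01[OF that] by (simp add: cantor_sum_def)
    also have "(\<Sum>n. a (Suc n) * (1/3) ^ Suc n) = (\<Sum>n. (1/3) * (a (Suc n) * (1/3) ^ n))"
      by (simp add: algebra_simps)
    also have "\<dots> = (1/3) * cantor_sum (\<lambda>n. a (Suc n))"
      unfolding cantor_sum_def by (rule suminf_mult) (intro cantor_sum_summable 01 that)
    finally show ?thesis by simp
  qed
  have bound: "0 \<le> cantor_sum a" "cantor_sum a \<le> 3/2" if "\<And>n. a n \<in> {0, 1}" for a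
  proof -
    have s: "summable (\<lambda>n. a n * (1/3) ^ n)" by (intro cantor_sum_summable 01 that)
    have a: "0 \<le> a n" "a n \<le> 1" for n using 01[OF that[of n]] by auto
    show "0 \<le> cantor_sum a"
      unfolding cantor_sum_def by (intro suminf_nonneg s) (simp add: a)
    have "cantor_sum a \<le> (\<Sum>n. (1/3) ^ n)"
      unfolding cantor_sum_def by (intro suminf_le s) (simp_all add: a mult_left_le_one_le)
    then show "cantor_sum a \<le> 3/2" by (simp add: suminf_geometric)
  qed
  have head: "a 0 = b 0 \<and> cantor_sum (\<lambda>n. a (Suc n)) = cantor_sum (\<lambda>n. b (Suc n))"
    if a: "\<And>n. a n \<in> {0, 1}" and b: "\<And>n. b n \<in> {0, 1}" and eq: "cantor_sum a = cantor_sum b" for a b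
    using step[of a, OF a] step[of b, OF b] eq a[of 0] b[of 0]
      bound[of "\<lambda>n. a (Suc n)", OF a] bound[of "\<lambda>n. b (Suc n)", OF b] by auto
  fix n
  show "a n = b n"
    using assms
  proof (induction n arbitrary: a b)
    case 0
    then show ?case using head[of a b] by blast
  next
    case (Suc n)
    show ?case
      by (rule Suc.IH[of "\<lambda>n. a (Suc n)" "\<lambda>n. b (Suc n)"]) (use Suc.prems head[of a b] in blast)+
  qed
qed

lemma continuous_on_cantor_sum: "continuous_on {a. \<forall>n. a n \<in> {0..1}} cantor_sum"
proof -
  let ?A = "{a :: nat \<Rightarrow> real. \<forall>n. a n \<in> {0..1}}"
  have U: "uniform_limit ?A (\<lambda>n a. \<Sum>i<n. a i * (1/3) ^ i) (\<lambda>a. \<Sum>i. a i * (1/3) ^ i) sequentially"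
    by (rule Weierstrass_m_test[where M = "\<lambda>n. (1/3) ^ n"])
       (auto simp: abs_mult intro!: mult_left_le_one_le)
  have "continuous_on ?A (\<lambda>a. \<Sum>i<n. a i * (1/3) ^ i)" for n
    by (intro continuous_intros continuous_on_product_then_coordinatewise continuous_on_id)
  then have "continuous_on ?A (\<lambda>a. \<Sum>i. a i * (1/3) ^ i)"
    by (intro uniform_limit_theorem[OF _ U] always_eventually allI) simp_all
  then show ?thesis by (simp add: cantor_sum_def[abs_def])
qed

text \<open>Digit \<open>n\<close> of the code of \<open>x\<close> records on which side of a rational threshold a coordinate of \<open>x\<close>
  lies.  Allowing either digit at the threshold makes the set of (code, point) pairs compact, so
  that decoding is continuous although coding is only Borel.\<close>

lemma compact_sequences_Borel_code:
  fixes K :: "(nat \<Rightarrow> real) set"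
  assumes K: "compact K"
  obtains s :: "(nat \<Rightarrow> real) \<Rightarrow> real" and C \<phi> where
    "s \<in> borel_measurable borel" "compact C" "s ` K \<subseteq> C" "continuous_on C \<phi>" "\<phi> ` C \<subseteq> K"
    "\<forall>x\<in>K. \<phi> (s x) = x"
proof -
  \<comment> \<open>Each \<open>n\<close> stands for a question: is coordinate \<open>i n\<close>
    above the rational \<open>q n\<close>? Surjectivity of \<open>from_nat\<close> ensures that
    every such question is asked.\<close>
  define i where "i n = fst (from_nat n :: nat \<times> rat)" for n
  define q where "q n = real_of_rat (snd (from_nat n :: nat \<times> rat))" for n
  define bits where "bits x n = (if x (i n) > q n then 1 else 0::real)" for x n
  define s where "s = (\<lambda>x. cantor_sum (bits x))"
  \<comment> \<open>The three equations say that each digit is 0 or 1, that digit 1 forces the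
    coordinate to be at least the threshold, and that digit 0 forces it to be at most the threshold.
    As equations between continuous functions they make \<open>D\<close> closed.\<close>
  define D where "D = {p :: (nat \<Rightarrow> real) \<times> (nat \<Rightarrow> real). \<forall>n. fst p n * (1 - fst p n) = 0 \<and>
      fst p n * max 0 (q n - snd p (i n)) = 0 \<and> (1 - fst p n) * max 0 (snd p (i n) - q n) = 0}"
  define A where "A = {a :: nat \<Rightarrow> real. \<forall>n. a n \<in> {0..1}}"
  define D' where "D' = (A \<times> K) \<inter> D"
  have c1: "continuous_on UNIV (\<lambda>p :: (nat \<Rightarrow> real) \<times> (nat \<Rightarrow> real). fst p n)" for n
    by (rule continuous_on_product_then_coordinatewise[OF continuous_on_fst[OF continuous_on_id]])
  have c2: "continuous_on UNIV (\<lambda>p :: (nat \<Rightarrow> real) \<times> (nat \<Rightarrow> real). snd p n)" for n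
    by (rule continuous_on_product_then_coordinatewise[OF continuous_on_snd[OF continuous_on_id]])
  have "compactin (product_topology (\<lambda>i. euclideanreal) UNIV) (PiE UNIV (\<lambda>i::nat. {0..1}))"
    by (simp add: compactin_PiE)
  moreover have "PiE UNIV (\<lambda>i::nat. {0..1::real}) = A"
    by (auto simp: A_def PiE_def Pi_def)
  ultimately have "compact A" by (simp add: euclidean_product_topology)
  moreover have "closed D"
    unfolding D_def by (intro closed_Collect_all closed_Collect_conj closed_Collect_eq continuous_intros c1 c2)
  ultimately have D': "compact D'" unfolding D'_def using K by (intro compact_Int_closed compact_Times)
  have Dn: "fst p n = 0 \<and> snd p (i n) \<le> q n \<or> fst p n = 1 \<and> q n \<le> snd p (i n)" if "p \<in> D'" for p n
  proof -
    have 0: "fst p n * (1 - fst p n) = 0" and 1: "fst p n * max 0 (q n - snd p (i n)) = 0"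
      and 2: "(1 - fst p n) * max 0 (snd p (i n) - q n) = 0"
      using that unfolding D'_def D_def by blast+
    from 0 have "fst p n = 0 \<or> fst p n = 1" by auto
    then show ?thesis
    proof
      assume "fst p n = 0"
      with 2 show ?thesis by simp
    next
      assume "fst p n = 1"
      with 1 show ?thesis by simp
    qed
  qed
  define f where "f p = cantor_sum (fst p)" for p :: "(nat \<Rightarrow> real) \<times> (nat \<Rightarrow> real)"
  have cf: "continuous_on D' f"
    unfolding f_def
    by (rule continuous_on_compose2[OF continuous_on_cantor_sum])
       (auto simp: D'_def A_def intro!: continuous_on_fst continuous_on_id)
  have inj: "inj_on f D'"
  proof (rule inj_onI)
    fix p p' assume p: "p \<in> D'" and p': "p' \<in> D'" and eq: "f p = f p'"
    have fst: "fst p = fst p'"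
      using Dn[OF p] Dn[OF p'] eq unfolding f_def by (intro cantor_sum_inj) auto
    \<comment> \<open>A rational strictly between the two coordinates is a threshold hit by neither,
      so the digits there are forced to be 0 and 1. The ambiguity at thresholds thus does not affect
      decoding.\<close>
    have "\<not> snd p j < snd p' j" if p: "p \<in> D'" and p': "p' \<in> D'" and fst: "fst p = fst p'" for p p' j
    proof
      assume "snd p j < snd p' j"
      then obtain r where r: "snd p j < real_of_rat r" "real_of_rat r < snd p' j"
        using of_rat_dense by blast
      obtain n where "(j, r) = from_nat n" by (metis surj_from_nat surjD)
      then have "i n = j" "q n = real_of_rat r" by (simp_all add: i_def q_def flip: \<open>(j, r) = from_nat n\<close>)
      then show False using Dn[OF p, of n] Dn[OF p', of n] r fst by auto
    qed
    from this[OF p p' fst] this[OF p' p fst[symmetric]] have "snd p = snd p'"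
      by (intro ext) (meson linorder_neqE)
    then show "p = p'" using fst by (simp add: prod_eq_iff)
  qed
  define \<phi> where "\<phi> = snd \<circ> inv_into D' f"
  have "continuous_on (f ` D') (inv_into D' f)"
    by (rule continuous_on_inv[OF cf D']) (use inj in auto)
  then have "continuous_on (f ` D') \<phi>"
    unfolding \<phi>_def o_def by (rule continuous_on_snd)
  moreover have "s \<in> borel_measurable borel"
  proof -
    have [measurable]: "(\<lambda>x :: nat \<Rightarrow> real. x n) \<in> borel_measurable borel" for n
      by (rule borel_measurable_continuous_onI) simp
    show ?thesis
      unfolding s_def cantor_sum_def bits_def by measurable
  qed
  moreover have "compact (f ` D')" by (rule compact_continuous_image[OF cf D'])
  moreover have code: "(bits x, x) \<in> D'" if "x \<in> K" for x
    using that by (auto simp: D'_def D_def A_def bits_def)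
  have sf: "s x = f (bits x, x)" for x by (simp add: s_def f_def)
  have "s ` K \<subseteq> f ` D'" using code sf by auto
  moreover have "\<phi> ` f ` D' \<subseteq> K" using inj by (auto simp: \<phi>_def D'_def)
  moreover have "\<forall>x\<in>K. \<phi> (s x) = x"
    using code inj by (simp add: sf \<phi>_def)
  ultimately show thesis using that by blast
qed

section \<open>Subsequential limits of measures on compact sets of sequences\<close>

text \<open>Weak convergence can be applied to the truncated distance to \<open>C\<close>, a bounded
  continuous function vanishing exactly on \<open>C\<close>: its integrals are all 0, hence so is
  the limit. Since \<open>infdist x {}\<close> is 0, this needs \<open>C\<close> nonempty.\<close>

lemma closed_support_weak_limit:
  assumes \<nu>: "\<And>n. real_distribution (\<nu> n)" and N: "real_distribution N" and w: "weak_conv_m \<nu> N"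
    and C: "closed C" "\<And>n. AE x in \<nu> n. x \<in> C"
  shows "AE x in N. x \<in> C"
proof (cases "C = {}")
  case True
  interpret real_distribution "\<nu> 0" by (rule \<nu>)
  have False using C(2)[of 0] True by simp
  then show ?thesis by simp
next
  case False
  interpret N: real_distribution N by (rule N)
  define g where "g x = min 1 (infdist x C)" for x :: real
  have g: "isCont g x" "norm (g x) \<le> 1" "0 \<le> g x" for x
    unfolding g_def by (auto intro!: continuous_intros simp: infdist_nonneg)
  have gm: "g \<in> borel_measurable borel"
    using g(1) by (intro borel_measurable_continuous_onI continuous_at_imp_continuous_on) auto
  have "(\<lambda>n. integral\<^sup>L (\<nu> n) g) \<longlonglongrightarrow> integral\<^sup>L N g"
    by (rule weak_conv_imp_integral_bdd_continuous_conv[OF \<nu> N w g(1,2)])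
  moreover have "integral\<^sup>L (\<nu> n) g = 0" for n
    using C(2)[of n] by (intro integral_eq_zero_AE) (auto simp: g_def)
  ultimately have "integral\<^sup>L N g = 0"
    by (simp add: LIMSEQ_const_iff)
  moreover have "integrable N g"
    using gm g(2) by (intro N.integrable_const_bound[of _ 1]) auto
  ultimately have "AE x in N. g x = 0"
    using g(3) by (subst (asm) integral_nonneg_eq_0_iff_AE) auto
  then show ?thesis
    by (rule AE_mp) (use in_closed_iff_infdist_zero[OF C(1) False] in \<open>auto simp: g_def min_def split: if_splits\<close>)
qed

text \<open>Helly's theorem applied to the codes; continuous functions of the decoded point extend to
  bounded continuous functions on the line by Tietze.\<close>

lemma prob_on_compact_sequences_convergent_subsequence:
  fixes \<mu> :: "nat \<Rightarrow> (nat \<Rightarrow> real) measure"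
  assumes K: "compact K" and sets: "\<And>n. sets (\<mu> n) = sets borel" and P: "\<And>n. prob_space (\<mu> n)"
    and AE: "\<And>n. AE x in \<mu> n. x \<in> K"
  obtains r M where "strict_mono (r :: nat \<Rightarrow> nat)" "sets M = sets borel" "prob_space M"
    "AE x in M. x \<in> K"
    "\<forall>f :: (nat \<Rightarrow> real) \<Rightarrow> real. continuous_on K f \<longrightarrow>
      (\<lambda>n. \<integral>x. indicator K x *\<^sub>R f x \<partial>\<mu> (r n)) \<longlonglongrightarrow> (\<integral>x. indicator K x *\<^sub>R f x \<partial>M)"
proof -
  obtain s :: "(nat \<Rightarrow> real) \<Rightarrow> real" and C \<phi>
    where s: "s \<in> borel_measurable borel" and C: "compact C" "s ` K \<subseteq> C"
    and \<phi>: "continuous_on C \<phi>" "\<phi> ` C \<subseteq> K" "\<forall>x\<in>K. \<phi> (s x) = x"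
    by (rule compact_sequences_Borel_code[OF K])
  have s': "s \<in> measurable (\<mu> n) borel" for n
    using s sets[of n] by (simp cong: measurable_cong_sets)
  define \<nu> where "\<nu> n = distr (\<mu> n) borel s" for n
  have \<nu>: "real_distribution (\<nu> n)" for n
    unfolding \<nu>_def real_distribution_def real_distribution_axioms_def
    using prob_space.prob_space_distr[OF P s'] by simp
  have C': "closed C" "C \<in> sets borel" using C(1) by (simp_all add: compact_imp_closed borel_closed)
  have \<nu>C: "AE x in \<nu> n. x \<in> C" for n
    unfolding \<nu>_def using AE[of n] C(2) C'(2)
    by (subst AE_distr_iff[OF s']) (auto elim!: AE_mp)
  obtain B where B: "B > 0" "\<And>x. x \<in> C \<Longrightarrow> \<bar>x\<bar> < B"
    using compact_imp_bounded[OF C(1)] unfolding bounded_pos_less by auto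
  \<comment> \<open>All coded measures live on the bounded set \<open>C\<close>, so one interval has
    full mass for every \<open>n\<close> and serves every \<open>\<epsilon>\<close>.\<close>
  have "tight \<nu>"
    unfolding tight_def
  proof (intro conjI allI impI \<nu>)
    fix \<epsilon> :: real assume \<epsilon>: "\<epsilon> > 0"
    have "measure (\<nu> n) {-B<..B} > 1 - \<epsilon>" for n
    proof -
      interpret real_distribution "\<nu> n" by (rule \<nu>)
      have "AE x in \<nu> n. x \<in> {-B<..B}"
        by (rule AE_mp[OF \<nu>C]) (use B(2) in \<open>force intro!: AE_I2\<close>)
      then have "measure (\<nu> n) {-B<..B} = 1"
        by (subst prob_eq_1) auto
      then show ?thesis using \<epsilon> by simp
    qed
    moreover have "-B < B" using B(1) by simp
    ultimately show "\<exists>a b. a < b \<and> (\<forall>n. 1 - \<epsilon> < measure (\<nu> n) {a<..b})" by blast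
  qed
  from tight_imp_convergent_subsubsequence[OF this strict_mono_id]
  obtain r N where r: "strict_mono (r :: nat \<Rightarrow> nat)" and N: "real_distribution N"
    and w: "weak_conv_m (\<lambda>n. \<nu> (r n)) N"
    by (auto simp: o_def)
  interpret N: real_distribution N by (rule N)
  have NC: "AE x in N. x \<in> C"
    by (rule closed_support_weak_limit[OF \<nu> N w C'(1) \<nu>C])
  have "C \<noteq> {}"
  proof
    assume "C = {}"
    then show False using NC by simp
  qed
  then obtain c where c: "c \<in> C" by blast
  \<comment> \<open>Off \<open>C\<close>, which is \<open>N\<close>-null, any value in
    \<open>K\<close> would do; \<open>\<phi> c\<close> keeps the image measure inside
    \<open>K\<close>.\<close>
  define \<Phi> where "\<Phi> x = (if x \<in> C then \<phi> x else \<phi> c)" for x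
  have \<Phi>m: "\<Phi> \<in> measurable N borel"
    using borel_measurable_continuous_on_if[OF C'(2) \<phi>(1) continuous_on_const]
    unfolding \<Phi>_def by (simp cong: measurable_cong_sets)
  have Km: "K \<in> sets borel" using K by (simp add: compact_imp_closed borel_closed)
  have \<Phi>K: "\<Phi> x \<in> K" for x using \<phi>(2) c by (auto simp: \<Phi>_def)
  define M where "M = distr N borel \<Phi>"
  have "AE x in M. x \<in> K"
    unfolding M_def using \<Phi>K Km by (subst AE_distr_iff[OF \<Phi>m]) auto
  moreover have "(\<lambda>n. \<integral>x. indicator K x *\<^sub>R f x \<partial>\<mu> (r n)) \<longlonglongrightarrow> (\<integral>x. indicator K x *\<^sub>R f x \<partial>M)"
    if f: "continuous_on K f" for f :: "(nat \<Rightarrow> real) \<Rightarrow> real"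
  proof -
    have fm: "(\<lambda>x. indicator K x *\<^sub>R f x) \<in> borel_measurable borel"
      by (rule borel_measurable_continuous_on_indicator[OF Km f])
    obtain b where b: "b > 0" "\<And>x. x \<in> K \<Longrightarrow> norm (f x) \<le> b"
      using compact_imp_bounded[OF compact_continuous_image[OF f K]] unfolding bounded_pos by auto
    have "continuous_on C (\<lambda>x. f (\<phi> x))"
      by (rule continuous_on_compose2[OF f \<phi>(1,2)])
    moreover have "norm (f (\<phi> x)) \<le> b" if "x \<in> C" for x
      using b(2) \<phi>(2) that by blast
    ultimately obtain g where g: "continuous_on UNIV g" "\<And>x. x \<in> C \<Longrightarrow> g x = f (\<phi> x)"
      "\<And>x. norm (g x) \<le> b"
      using Tietze[of C "\<lambda>x. f (\<phi> x)" UNIV b] C'(1) b(1) by auto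
    have gm: "g \<in> borel_measurable borel" by (rule borel_measurable_continuous_onI[OF g(1)])
    have "(\<lambda>n. integral\<^sup>L (\<nu> (r n)) g) \<longlonglongrightarrow> integral\<^sup>L N g"
      using g by (intro weak_conv_imp_integral_bdd_continuous_conv[OF \<nu> N w])
        (auto simp: continuous_on_eq_continuous_at)
    moreover have "integral\<^sup>L (\<nu> n) g = (\<integral>x. indicator K x *\<^sub>R f x \<partial>\<mu> n)" for n
    proof -
      have "integral\<^sup>L (\<nu> n) g = (\<integral>x. g (s x) \<partial>\<mu> n)"
        unfolding \<nu>_def by (rule integral_distr[OF s' gm])
      also have "\<dots> = (\<integral>x. indicator K x *\<^sub>R f x \<partial>\<mu> n)"
      proof (rule integral_cong_AE)
        show "(\<lambda>x. g (s x)) \<in> borel_measurable (\<mu> n)" by (rule measurable_compose[OF s' gm])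
        show "(\<lambda>x. indicator K x *\<^sub>R f x) \<in> borel_measurable (\<mu> n)"
          using fm sets[of n] by (simp cong: measurable_cong_sets)
        show "AE x in \<mu> n. g (s x) = indicator K x *\<^sub>R f x"
          by (rule AE_mp[OF AE]) (use g(2) C(2) \<phi>(3) in \<open>auto intro!: AE_I2\<close>)
      qed
      finally show ?thesis .
    qed
    moreover have "(\<integral>x. indicator K x *\<^sub>R f x \<partial>M) = integral\<^sup>L N g"
    proof -
      have "(\<integral>x. indicator K x *\<^sub>R f x \<partial>M) = (\<integral>x. indicator K (\<Phi> x) *\<^sub>R f (\<Phi> x) \<partial>N)"
        unfolding M_def by (rule integral_distr[OF \<Phi>m fm])
      also have "\<dots> = integral\<^sup>L N g"
      proof (rule integral_cong_AE)
        show "g \<in> borel_measurable N" using gm by simp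
        show "(\<lambda>x. indicator K (\<Phi> x) *\<^sub>R f (\<Phi> x)) \<in> borel_measurable N"
          by (rule measurable_compose[OF \<Phi>m fm])
        show "AE x in N. indicator K (\<Phi> x) *\<^sub>R f (\<Phi> x) = g x"
          by (rule AE_mp[OF NC]) (use \<phi>(2) g(2) in \<open>auto intro!: AE_I2 simp: \<Phi>_def indicator_def\<close>)
      qed
      finally show ?thesis .
    qed
    ultimately show ?thesis by simp
  qed
  moreover have "sets M = sets borel" "prob_space M"
    unfolding M_def using N.prob_space_distr[OF \<Phi>m] by simp_all
  ultimately show thesis using that[OF r] by blast
qed

section \<open>Regularity and determination of Radon measures\<close>

text \<open>Finite Borel measures on Polish spaces are regular. Applied to a limit measure on real
  sequences, this is the source of the regularity later carried back to \<open>K\<close>.\<close>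

lemma prob_space_borel_radon:
  fixes M :: "'a::{second_countable_topology, complete_space} measure"
  assumes sets: "sets M = sets borel" and P: "prob_space M"
  shows "M \<in> radon_prob_measures euclidean"
proof -
  interpret prob_space M by (rule P)
  have [simp]: "compact C \<Longrightarrow> C \<in> sets M" for C
    using sets by (simp add: compact_imp_closed borel_closed)
  have "emeasure M A = (SUP C\<in>{C. C \<subseteq> A \<and> compactin euclidean C \<and> C \<in> sets M}. emeasure M C) \<and>
      emeasure M A = (INF U\<in>{U. A \<subseteq> U \<and> openin euclidean U}. emeasure M U)" if "A \<in> sets M" for A
  proof -
    have "{C. C \<subseteq> A \<and> compactin euclidean C \<and> C \<in> sets M} = {C. C \<subseteq> A \<and> compact C}"
      by auto
    moreover have "emeasure M (space M) \<noteq> \<infinity>" by simp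
    ultimately show ?thesis
      using inner_regular[OF sets, of A] outer_regular[OF sets, of A] that sets by simp
  qed
  moreover have "space M = topspace euclidean" using sets_eq_imp_space_eq[OF sets] by simp
  moreover have "sets M = sigma_sets (topspace euclidean) {U. openin euclidean U}"
    using sets by (simp add: borel_def)
  ultimately show ?thesis
    unfolding radon_prob_measures_def mem_Collect_eq using P by blast
qed

lemma radon_prob_measures_outer_regular:
  assumes "M \<in> radon_prob_measures K" "A \<in> sets M"
  shows "emeasure M A = (INF U\<in>{U. A \<subseteq> U \<and> openin K U}. emeasure M U)"
  using assms unfolding radon_prob_measures_def by blast

text \<open>Outer regularity expresses the measure of any Borel set through open sets alone.\<close>

lemma measure_eq_if_open_eq:
  assumes "M \<in> radon_prob_measures K" "N \<in> radon_prob_measures K"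
    and "\<And>U. openin K U \<Longrightarrow> measure M U = measure N U"
  shows "M = N"
proof (rule measure_eqI)
  note M = radon_prob_measuresD[OF assms(1)] and N = radon_prob_measuresD[OF assms(2)]
  interpret M: prob_space M by (rule M)
  interpret N: prob_space N by (rule N)
  show s: "sets M = sets N" using M N by simp
  fix A assume A: "A \<in> sets M"
  have "emeasure M A = (INF U\<in>{U. A \<subseteq> U \<and> openin K U}. emeasure M U)"
    by (rule radon_prob_measures_outer_regular[OF assms(1) A])
  also have "\<dots> = (INF U\<in>{U. A \<subseteq> U \<and> openin K U}. emeasure N U)"
    using assms(3) by (intro INF_cong) (auto simp: M.emeasure_eq_measure N.emeasure_eq_measure)
  also have "\<dots> = emeasure N A"
    by (rule radon_prob_measures_outer_regular[OF assms(2), symmetric]) (use A s in simp)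
  finally show "emeasure M A = emeasure N A" .
qed

text \<open>Every open set is the increasing union of members of a countable family of open sets, and
  \<open>min 1 (m * g)\<close> increases to the indicator of \<open>{x. g x > 0}\<close>.\<close>

lemma countable_functions_determine_radon_measure:
  fixes K :: "'k topology" and h :: "'k \<Rightarrow> nat \<Rightarrow> real"
  assumes K: "compact_space K" and h: "embedding_map K euclidean h"
  obtains F :: "nat \<Rightarrow> 'k \<Rightarrow> real" where "\<forall>n. continuous_map K euclideanreal (F n)"
    "inj_on (\<lambda>M n. integral\<^sup>L M (F n)) (radon_prob_measures K)"
proof -
  have ch: "continuous_map K euclidean h"
    using h unfolding embedding_map_def
    by (meson continuous_map_in_subtopology homeomorphic_imp_continuous_map)
  obtain \<B> :: "(nat \<Rightarrow> real) set set" where B: "countable \<B>" "topological_basis \<B>"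
    using ex_countable_basis by blast
  \<comment> \<open>Closing the basis under finite unions keeps it countable and lets every open set
    be exhausted by an increasing sequence from the family, as continuity from below
    requires.\<close>
  define \<W> where "\<W> = Union ` {\<F>. \<F> \<subseteq> \<B> \<and> finite \<F>}"
  have cW: "countable \<W>"
    unfolding \<W>_def using countable_Collect_finite_subset[OF B(1)] by (simp add: conj_commute)
  have oW: "open W" if "W \<in> \<W>" for W using that topological_basis_open[OF B(2)] by (auto simp: \<W>_def)
  have eW: "{} \<in> \<W>" unfolding \<W>_def by blast
  define w where "w k = from_nat_into \<W> k" for k
  have w: "open (w k)" for k
    unfolding w_def using oW from_nat_into[of \<W> k] eW by blast
  \<comment> \<open>\<open>infdist x {} = 0\<close>, hence the case distinction\<close>
  define g where "g k x = (if w k = UNIV then 1 else infdist x (- w k))" for k x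
  have g: "continuous_on UNIV (g k)" "0 \<le> g k x" "g k x > 0 \<longleftrightarrow> x \<in> w k" for k x
  proof -
    show "continuous_on UNIV (g k)"
      unfolding g_def by (cases "w k = UNIV") (auto intro!: continuous_intros)
    show "0 \<le> g k x" by (simp add: g_def infdist_nonneg)
    have "x \<in> - w k \<longleftrightarrow> infdist x (- w k) = 0" if "w k \<noteq> UNIV"
      by (rule in_closed_iff_infdist_zero) (use w[of k] that in \<open>auto simp: closed_def\<close>)
    then show "g k x > 0 \<longleftrightarrow> x \<in> w k"
      using infdist_nonneg[of x "- w k"] by (auto simp: g_def less_le)
  qed
  define G where "G k m x = min 1 (real m * g k (h x))" for k m x
  have cG: "continuous_map K euclideanreal (G k m)" for k m
  proof -
    have "continuous_map euclidean euclideanreal (\<lambda>y. min 1 (real m * g k y))"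
      using g(1) by (auto intro!: continuous_intros)
    from continuous_map_compose[OF ch this] show ?thesis by (simp add: G_def[abs_def] o_def)
  qed
  have det: "M = N" if M: "M \<in> radon_prob_measures K" and N: "N \<in> radon_prob_measures K"
    and eq: "\<And>k m. integral\<^sup>L M (G k m) = integral\<^sup>L N (G k m)" for M N
  proof (rule measure_eq_if_open_eq[OF M N])
    have lim: "(\<lambda>m. integral\<^sup>L L (G k m)) \<longlonglongrightarrow> measure L {x \<in> topspace K. h x \<in> w k}"
      if L: "L \<in> radon_prob_measures K" for L k
    proof -
      note L' = radon_prob_measuresD[OF L]
      interpret prob_space L by (rule L')
      have "openin K {x \<in> topspace K. h x \<in> w k}"
        using openin_continuous_map_preimage[OF ch] w by simp
      then have m: "{x \<in> topspace K. h x \<in> w k} \<in> sets L" using L' by auto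
      have "(\<lambda>m. integral\<^sup>L L (G k m)) \<longlonglongrightarrow> (\<integral>x. indicator {x \<in> topspace K. h x \<in> w k} x \<partial>L)"
      proof (rule integral_dominated_convergence[where w = "\<lambda>_. 1"])
        show "G k m \<in> borel_measurable L" for m
          by (rule borel_measurable_if_continuous_map[OF L'(1,2) cG])
        show "AE x in L. norm (G k m x) \<le> 1" for m
          using g(2) by (auto simp: G_def intro!: AE_I2)
        show "AE x in L. (\<lambda>m. G k m x) \<longlonglongrightarrow> indicator {x \<in> topspace K. h x \<in> w k} x"
        proof (rule AE_I2)
          fix x assume x: "x \<in> space L"
          show "(\<lambda>m. G k m x) \<longlonglongrightarrow> indicator {x \<in> topspace K. h x \<in> w k} x"
          proof (cases "h x \<in> w k")
            case True
            then have pos: "g k (h x) > 0" using g(3) by blast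
            obtain m0 :: nat where m0: "1 / g k (h x) < m0" using reals_Archimedean2 by blast
            have "G k m x = 1" if "m \<ge> m0" for m
            proof -
              have "1 / g k (h x) \<le> m" using m0 that by linarith
              then show ?thesis using pos by (simp add: G_def field_simps)
            qed
            then have "eventually (\<lambda>m. G k m x = 1) sequentially"
              by (auto simp: eventually_sequentially)
            then show ?thesis
              using True x L'(1) by (simp add: tendsto_eventually)
          next
            case False
            then have "g k (h x) = 0" using g(2,3)[of k "h x"] by linarith
            then show ?thesis using False by (simp add: G_def)
          qed
        qed
      qed (use m in auto)
      then show ?thesis using m by simp
    qed
    fix U assume U: "openin K U"
    obtain S where S: "open S" "U = {x \<in> topspace K. h x \<in> S}"
    proof -
      have "openin (subtopology euclidean (h ` topspace K)) (h ` U)"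
        using h U openin_subset[OF U] unfolding embedding_map_def
        by (metis homeomorphic_map_openness)
      then obtain S where S: "open S" "h ` U = S \<inter> h ` topspace K"
        unfolding openin_subtopology by auto
      have inj: "inj_on h (topspace K)"
        using h unfolding embedding_map_def using homeomorphic_imp_injective_map by blast
      have "U = {x \<in> topspace K. h x \<in> S}"
        using S(2) inj openin_subset[OF U] by (auto dest: inj_onD)
      then show ?thesis using that S(1) by blast
    qed
    obtain \<U> where UB: "\<U> \<subseteq> \<B>" "S = \<Union>\<U>" using B(2) S(1) unfolding topological_basis_def by blast
    show "measure M U = measure N U"
    proof (cases "\<U> = {}")
      case True
      then show ?thesis using UB S(2) by simp
    next
      case False
      have cU: "countable \<U>" using UB(1) B(1) countable_subset by blast
      \<comment> \<open>If \<open>\<U>\<close> is finite the enumeration repeats members, which does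
        not affect the increasing union.\<close>
      define W where "W n = \<Union> (from_nat_into \<U> ` {..n})" for n :: nat
      have WW: "W n \<in> \<W>" for n
        unfolding W_def \<W>_def using UB(1) from_nat_into[OF False] by (intro imageI) auto
      have "\<exists>k. w k = W n" for n
        unfolding w_def using from_nat_into_surj[OF cW WW] by metis
      then obtain k where k: "\<And>n. w (k n) = W n" by metis
      have UW: "S = (\<Union>n. W n)"
        unfolding W_def UB(2) using range_from_nat_into[OF False cU] by blast
      have lim2: "(\<lambda>n. measure L {x \<in> topspace K. h x \<in> W n}) \<longlonglongrightarrow> measure L U"
        if L: "L \<in> radon_prob_measures K" for L
      proof -
        note L' = radon_prob_measuresD[OF L]
        interpret prob_space L by (rule L')
        have "openin K {x \<in> topspace K. h x \<in> W n}" for n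
          using openin_continuous_map_preimage[OF ch] oW[OF WW] by simp
        then have "range (\<lambda>n. {x \<in> topspace K. h x \<in> W n}) \<subseteq> sets L" using L' by auto
        moreover have "incseq (\<lambda>n. {x \<in> topspace K. h x \<in> W n})"
          unfolding incseq_def W_def by fastforce
        moreover have "(\<Union>n. {x \<in> topspace K. h x \<in> W n}) = U"
          using UW S(2) by auto
        ultimately show ?thesis using finite_Lim_measure_incseq by metis
      qed
      have "measure M {x \<in> topspace K. h x \<in> W n} = measure N {x \<in> topspace K. h x \<in> W n}" for n
        using LIMSEQ_unique[OF lim[OF M, of "k n"]] lim[OF N, of "k n"] eq k[of n] by simp
      then show ?thesis
        using LIMSEQ_unique[OF lim2[OF M]] lim2[OF N] by simp
    qed
  qed
  show thesis
  proof (rule that[of "\<lambda>n. G (fst (prod_decode n)) (snd (prod_decode n))"])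
    show "\<forall>n. continuous_map K euclideanreal (G (fst (prod_decode n)) (snd (prod_decode n)))"
      using cG by blast
    show "inj_on (\<lambda>M n. integral\<^sup>L M (G (fst (prod_decode n)) (snd (prod_decode n)))) (radon_prob_measures K)"
    proof (rule inj_onI)
      fix M N assume MN: "M \<in> radon_prob_measures K" "N \<in> radon_prob_measures K"
        and eq: "(\<lambda>n. integral\<^sup>L M (G (fst (prod_decode n)) (snd (prod_decode n)))) =
          (\<lambda>n. integral\<^sup>L N (G (fst (prod_decode n)) (snd (prod_decode n))))"
      show "M = N"
      proof (rule det[OF MN])
        show "integral\<^sup>L M (G k m) = integral\<^sup>L N (G k m)" for k m
          using fun_cong[OF eq, of "prod_encode (k, m)"] by simp
      qed
    qed
  qed
qed

section \<open>Compactness and metrizability of P(K)\<close>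

text \<open>The measures are pushed along \<open>h\<close> to a compact set of sequences, a limit is
  found there, and it is pushed back along the inverse of \<open>h\<close>. Convergence survives
  because \<open>f\<close> on \<open>K\<close> corresponds to \<open>f \<circ> g\<close> on
  \<open>K'\<close>; regularity of the returned measure needs an argument of its own.\<close>

lemma radon_prob_measures_convergent_subsequence:
  fixes K :: "'k topology" and h :: "'k \<Rightarrow> nat \<Rightarrow> real"
  assumes K: "compact_space K" and h: "embedding_map K euclidean h"
    and M: "\<And>n. M n \<in> radon_prob_measures K"
  obtains r L where "strict_mono (r :: nat \<Rightarrow> nat)" "L \<in> radon_prob_measures K"
    "\<forall>f. continuous_map K euclideanreal f \<longrightarrow> (\<lambda>n. \<integral>x. f x \<partial>M (r n)) \<longlonglongrightarrow> (\<integral>x. f x \<partial>L)"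
proof -
  let ?S = "sigma (topspace K) {U. openin K U}"
  have sub: "{U. openin K U} \<subseteq> Pow (topspace K)" using openin_subset by blast
  have S: "space ?S = topspace K" "sets ?S = sigma_sets (topspace K) {U. openin K U}"
    using sub by auto
  note M' = radon_prob_measuresD[OF M]
  define K' where "K' = h ` topspace K"
  obtain g where hg: "homeomorphic_maps K (top_of_set K') h g"
    using h unfolding embedding_map_def K'_def homeomorphic_map_maps by blast
  then have ch': "continuous_map K (top_of_set K') h" and cg: "continuous_map (top_of_set K') K g"
    and gh: "\<And>x. x \<in> topspace K \<Longrightarrow> g (h x) = x" and hg': "\<And>y. y \<in> K' \<Longrightarrow> h (g y) = y"
    unfolding homeomorphic_maps_def by auto
  have ch: "continuous_map K euclidean h"
    using ch' by (simp add: continuous_map_in_subtopology)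
  have "compactin euclidean K'"
    unfolding K'_def using image_compactin[OF _ ch] K unfolding compact_space_def by blast
  then have K': "compact K'" "closed K'" by (auto intro: compact_imp_closed)
  have hm: "h \<in> measurable (M n) borel" for n
    by (rule borel_measurable_if_continuous_map[OF M'(1,2) ch])
  define \<mu> where "\<mu> n = distr (M n) borel h" for n
  have \<mu>K': "AE x in \<mu> n. x \<in> K'" for n
    unfolding \<mu>_def using K'(2) M'(1)
    by (subst AE_distr_iff[OF hm]) (auto simp: K'_def)
  have \<mu>P: "prob_space (\<mu> n)" for n
    unfolding \<mu>_def by (rule prob_space.prob_space_distr[OF M'(3) hm])
  have \<mu>s: "sets (\<mu> n) = sets borel" for n by (simp add: \<mu>_def)
  obtain r N where r: "strict_mono (r :: nat \<Rightarrow> nat)" and N: "sets N = sets borel"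
    "prob_space N" "AE x in N. x \<in> K'"
    and lim: "\<forall>f :: (nat \<Rightarrow> real) \<Rightarrow> real. continuous_on K' f \<longrightarrow>
      (\<lambda>n. \<integral>x. indicator K' x *\<^sub>R f x \<partial>\<mu> (r n)) \<longlonglongrightarrow> (\<integral>x. indicator K' x *\<^sub>R f x \<partial>N)"
    by (rule prob_on_compact_sequences_convergent_subsequence[OF K'(1) \<mu>s \<mu>P \<mu>K'])
  have spN: "space N = UNIV" using sets_eq_imp_space_eq[OF N(1)] by simp
  interpret N: prob_space N by (rule N(2))
  have "topspace K \<noteq> {}"
    using prob_space.not_empty[OF M'(3)] M'(1) by simp
  then obtain x0 where x0: "x0 \<in> topspace K" by blast
  \<comment> \<open>The value \<open>x0\<close> only makes \<open>k\<close> total with values in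
    \<open>K\<close>; the complement of \<open>K'\<close> is \<open>N\<close>-null. Such a point
    exists because a probability space is nonempty.\<close>
  define k where "k y = (if y \<in> K' then g y else x0)" for y
  have gK: "g y \<in> topspace K" if "y \<in> K'" for y
    using that gh by (auto simp: K'_def)
  have km: "k \<in> measurable N ?S"
  proof (rule measurable_sigma_sets[OF S(2) sub])
    show "k \<in> space N \<rightarrow> topspace K" using x0 gK by (auto simp: k_def)
    fix U assume "U \<in> {U. openin K U}"
    then have "openin (top_of_set K') {y \<in> topspace (top_of_set K'). g y \<in> U}"
      by (intro openin_continuous_map_preimage[OF cg]) simp
    then obtain V where V: "open V" "{y \<in> K'. g y \<in> U} = V \<inter> K'"
      by (auto simp: openin_subtopology)
    have "k -` U \<inter> space N = (V \<inter> K') \<union> (if x0 \<in> U then - K' else {})"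
      unfolding V(2)[symmetric] spN by (auto simp: k_def split: if_splits)
    moreover have "V \<inter> K' \<in> sets borel" "- K' \<in> sets borel"
      using V(1) K'(2) by (auto intro!: borel_open borel_closed sets.Int)
    ultimately show "k -` U \<inter> space N \<in> sets N"
      unfolding N(1) by auto
  qed
  define L where "L = distr N ?S k"
  have L': "space L = topspace K" "sets L = sigma_sets (topspace K) {U. openin K U}" "prob_space L"
    unfolding L_def using N.prob_space_distr[OF km] S by simp_all
  have opL: "U \<in> sets L" if "openin K U" for U using that L'(2) by auto
  have clL: "C \<in> sets L" if "closedin K C" for C
  proof -
    have "space L - (topspace K - C) \<in> sets L"
      by (rule sets.compl_sets[OF opL[OF openin_diff[OF openin_topspace that]]])
    moreover have "topspace K - (topspace K - C) = C" using closedin_subset[OF that] by blast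
    ultimately show ?thesis by (simp only: L'(1))
  qed
  have Nr: "\<forall>A\<in>sets N. \<forall>e>0. \<exists>C U. compactin euclidean C \<and> C \<in> sets N \<and> openin euclidean U \<and>
      C \<subseteq> A \<and> A \<subseteq> U \<and> measure N (U - C) < e"
    using prob_space_borel_radon[OF N(1,2)] unfolding radon_prob_measures_iff by blast
  have "\<exists>C U. compactin K C \<and> C \<in> sets L \<and> openin K U \<and> C \<subseteq> A \<and> A \<subseteq> U \<and> measure L (U - C) < e"
    if A: "A \<in> sets L" and e: "e > 0" for A and e :: real
  proof -
    have AK: "A \<subseteq> topspace K" using sets.sets_into_space[OF A] L'(1) by simp
    have "k -` A \<inter> space N \<in> sets N"
      using A by (intro measurable_sets[OF km]) (simp add: L_def)
    then have "k -` A \<in> sets N" by (simp add: spN)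
    from bspec[OF Nr this, rule_format, OF e] obtain C' U' where C': "compact C'" "C' \<in> sets N" "C' \<subseteq> k -` A"
      and U': "open U'" "k -` A \<subseteq> U'" and CU: "measure N (U' - C') < e"
      by auto
    define C where "C = {x \<in> topspace K. h x \<in> C'}"
    define U where "U = {x \<in> topspace K. h x \<in> U'}"
    have U: "openin K U"
      unfolding U_def using U' by (intro openin_continuous_map_preimage[OF ch]) simp
    have C: "closedin K C"
      unfolding C_def using C' by (intro closedin_continuous_map_preimage[OF ch]) (simp add: compact_imp_closed)
    have kh: "k (h x) = x" if "x \<in> topspace K" for x
      using that gh by (simp add: k_def K'_def)
    have "C \<subseteq> A" using C'(3) kh unfolding C_def by force
    moreover have "A \<subseteq> U" using U'(2) kh AK unfolding U_def by force
    moreover have "measure L (U - C) < e"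
    proof -
      have UC: "U - C \<in> sets ?S" using opL[OF U] clL[OF C] by (auto simp: L_def)
      have "measure L (U - C) = measure N (k -` (U - C) \<inter> space N)"
        unfolding L_def by (rule measure_distr[OF km UC])
      also have "\<dots> \<le> measure N (U' - C')"
      proof (rule N.finite_measure_mono_AE)
        show "AE x in N. x \<in> k -` (U - C) \<inter> space N \<longrightarrow> x \<in> U' - C'"
          by (rule AE_mp[OF N(3)]) (use hg' gK in \<open>auto intro!: AE_I2 simp: k_def U_def C_def\<close>)
        show "U' - C' \<in> sets N" using U'(1) C'(2) N(1) by auto
      qed
      finally show ?thesis using CU by simp
    qed
    ultimately show ?thesis
      using U clL[OF C] closedin_compact_space[OF K C] by blast
  qed
  then have L: "L \<in> radon_prob_measures K"
    unfolding radon_prob_measures_iff using L' by blast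
  have "(\<lambda>n. \<integral>x. f x \<partial>M (r n)) \<longlonglongrightarrow> (\<integral>x. f x \<partial>L)" if f: "continuous_map K euclideanreal f" for f
  proof -
    have "continuous_map (top_of_set K') euclideanreal (f \<circ> g)"
      by (rule continuous_map_compose[OF cg f])
    then have c: "continuous_on K' (\<lambda>y. f (g y))" by (simp add: o_def)
    have m: "(\<lambda>y. indicator K' y *\<^sub>R f (g y)) \<in> borel_measurable borel"
      by (rule borel_measurable_continuous_on_indicator[OF borel_closed[OF K'(2)] c])
    have "(\<integral>y. indicator K' y *\<^sub>R f (g y) \<partial>\<mu> n) = (\<integral>x. f x \<partial>M n)" for n
    proof -
      have "(\<integral>y. indicator K' y *\<^sub>R f (g y) \<partial>\<mu> n) = (\<integral>x. indicator K' (h x) *\<^sub>R f (g (h x)) \<partial>M n)"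
        unfolding \<mu>_def by (rule integral_distr[OF hm m])
      also have "\<dots> = (\<integral>x. f x \<partial>M n)"
        by (rule Bochner_Integration.integral_cong) (auto simp: M'(1) gh K'_def)
      finally show ?thesis .
    qed
    moreover have "(\<integral>x. f x \<partial>L) = (\<integral>y. indicator K' y *\<^sub>R f (g y) \<partial>N)"
    proof -
      have fS: "f \<in> borel_measurable ?S" by (rule borel_measurable_if_continuous_map[OF S f])
      have "(\<integral>x. f x \<partial>L) = (\<integral>y. f (k y) \<partial>N)"
        unfolding L_def by (rule integral_distr[OF km fS])
      also have "\<dots> = (\<integral>y. indicator K' y *\<^sub>R f (g y) \<partial>N)"
      proof (rule integral_cong_AE)
        show "(\<lambda>y. f (k y)) \<in> borel_measurable N" by (rule measurable_compose[OF km fS])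
        show "(\<lambda>y. indicator K' y *\<^sub>R f (g y)) \<in> borel_measurable N"
          using m N(1) by (simp cong: measurable_cong_sets)
        show "AE y in N. f (k y) = indicator K' y *\<^sub>R f (g y)"
          by (rule AE_mp[OF N(3)]) (auto intro!: AE_I2 simp: k_def)
      qed
      finally show ?thesis .
    qed
    ultimately show ?thesis
      using lim[rule_format, OF c] by simp
  qed
  then show thesis using that[OF r L] by blast
qed

text \<open>The weak* topology is not known in advance to be metrizable, so sequential compactness
  is used on the image \<open>T\<close> in the metric space of sequences, where it amounts to
  compactness. The homeomorphism with \<open>T\<close> then carries compactness and metrizability
  back.\<close>

lemma compact_metrizable_prob_measure_space:
  fixes K :: "'k topology"
  assumes K: "compact_space K" "metrizable_space K"
  shows "compact_space (prob_measure_space K)" "metrizable_space (prob_measure_space K)"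
proof -
  let ?R = "radon_prob_measures K"
  obtain h :: "'k \<Rightarrow> nat \<Rightarrow> real" where "continuous_map K euclidean h" "inj_on h (topspace K)"
    by (rule compact_metrizable_embeds_in_sequences[OF K])
  then have h: "embedding_map K euclidean h"
    using K by (intro continuous_imp_embedding_map) auto
  obtain F :: "nat \<Rightarrow> 'k \<Rightarrow> real" where F: "\<forall>n. continuous_map K euclideanreal (F n)"
    and inj: "inj_on (\<lambda>M n. integral\<^sup>L M (F n)) ?R"
    by (rule countable_functions_determine_radon_measure[OF K(1) h])
  define \<Phi> where "\<Phi> M = (\<lambda>n. integral\<^sup>L M (F n))" for M
  have inj: "inj_on \<Phi> ?R" using inj by (simp add: \<Phi>_def[abs_def])
  have c\<Phi>: "continuous_map (prob_measure_space K) euclidean \<Phi>"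
    unfolding euclidean_product_topology[symmetric] continuous_map_componentwise_UNIV \<Phi>_def
    using F continuous_map_prob_measure_space_integral by blast
  have tend: "v \<longlonglongrightarrow> l" if "\<And>k. (\<lambda>n. v n k) \<longlonglongrightarrow> l k" for v :: "nat \<Rightarrow> nat \<Rightarrow> real" and l
  proof -
    have "limitin euclidean v l sequentially"
      unfolding euclidean_product_topology[symmetric] limitin_componentwise using that by simp
    then show ?thesis by simp
  qed
  define T where "T = \<Phi> ` ?R"
  define \<Psi> where "\<Psi> = inv_into ?R \<Phi>"
  have \<Psi>: "\<Psi> v \<in> ?R" "\<Phi> (\<Psi> v) = v" if "v \<in> T" for v
    using that unfolding \<Psi>_def T_def by (auto intro: inv_into_into f_inv_into_f)
  have \<Psi>\<Phi>: "\<Psi> (\<Phi> M) = M" if "M \<in> ?R" for M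
    unfolding \<Psi>_def using inj that by simp
  have "seq_compact T"
  proof (rule seq_compactI)
    fix v :: "nat \<Rightarrow> nat \<Rightarrow> real" assume v: "\<forall>n. v n \<in> T"
    obtain r L where r: "strict_mono (r :: nat \<Rightarrow> nat)" and L: "L \<in> ?R" and lim: "\<forall>f. continuous_map K euclideanreal f \<longrightarrow>
        (\<lambda>n. \<integral>x. f x \<partial>\<Psi> (v (r n))) \<longlonglongrightarrow> (\<integral>x. f x \<partial>L)"
      by (rule radon_prob_measures_convergent_subsequence[OF K(1) h, of "\<lambda>n. \<Psi> (v n)"])
         (use v \<Psi>(1) in blast)+
    have "(\<lambda>n. v (r n)) \<longlonglongrightarrow> \<Phi> L"
    proof (rule tend)
      fix k
      have "(\<lambda>n. \<Phi> (\<Psi> (v (r n))) k) \<longlonglongrightarrow> \<Phi> L k"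
        unfolding \<Phi>_def using lim F by blast
      then show "(\<lambda>n. v (r n) k) \<longlonglongrightarrow> \<Phi> L k"
        using v \<Psi>(2) by simp
    qed
    then show "\<exists>l\<in>T. \<exists>r. strict_mono r \<and> (v \<circ> r) \<longlonglongrightarrow> l"
      using r L unfolding T_def o_def by blast
  qed
  then have T: "compact T" by (simp add: compact_eq_seq_compact_metric)
  have "continuous_map (top_of_set T) (prob_measure_space K) \<Psi>"
  proof (rule continuous_map_into_prob_measure_space)
    show "\<Psi> \<in> topspace (top_of_set T) \<rightarrow> ?R" using \<Psi>(1) by simp
    fix f assume f: "continuous_map K euclideanreal f"
    \<comment> \<open>If the integrals failed to converge, infinitely many indices would stay
      \<open>\<epsilon>\<close> away. A convergent subsequence of those measures has a limit
      \<open>L\<close> with \<open>\<Phi> L = l\<close>, so \<open>L = \<Psi> l\<close> by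
      injectivity, a contradiction.\<close>
    have "continuous_on T (\<lambda>v. \<integral>x. f x \<partial>\<Psi> v)"
    proof (rule continuous_on_sequentiallyI, rule ccontr)
      fix v :: "nat \<Rightarrow> nat \<Rightarrow> real" and l assume v: "\<forall>n. v n \<in> T" and l: "l \<in> T" and vl: "v \<longlonglongrightarrow> l"
        and not: "\<not> (\<lambda>n. \<integral>x. f x \<partial>\<Psi> (v n)) \<longlonglongrightarrow> (\<integral>x. f x \<partial>\<Psi> l)"
      let ?I = "\<lambda>v. \<integral>x. f x \<partial>\<Psi> v"
      obtain \<epsilon> where "\<epsilon> > 0" and "infinite {n. \<not> dist (?I (v n)) (?I l) < \<epsilon>}"
        using not by (auto simp: tendsto_iff not_eventually INFM_iff_infinite cofinite_eq_sequentially[symmetric])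
      then obtain s :: "nat \<Rightarrow> nat" where s: "\<And>n. \<not> dist (?I (v (s n))) (?I l) < \<epsilon>" "strict_mono s"
        using enumerate_in_set enumerate_mono by (fastforce simp: strict_mono_def)
      obtain r L where r: "strict_mono (r :: nat \<Rightarrow> nat)" and L: "L \<in> ?R" and lim: "\<forall>f. continuous_map K euclideanreal f \<longrightarrow>
          (\<lambda>n. \<integral>x. f x \<partial>\<Psi> (v (s (r n)))) \<longlonglongrightarrow> (\<integral>x. f x \<partial>L)"
        by (rule radon_prob_measures_convergent_subsequence[OF K(1) h, of "\<lambda>n. \<Psi> (v (s n))"])
           (use v \<Psi>(1) in blast)+
      have "(\<lambda>n. v (s (r n))) \<longlonglongrightarrow> l"
        using LIMSEQ_subseq_LIMSEQ[OF vl strict_mono_o[OF s(2) r]] by (simp add: o_def)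
      moreover have "(\<lambda>n. v (s (r n))) \<longlonglongrightarrow> \<Phi> L"
      proof (rule tend)
        fix k
        have "(\<lambda>n. \<Phi> (\<Psi> (v (s (r n)))) k) \<longlonglongrightarrow> \<Phi> L k"
          unfolding \<Phi>_def using lim F by blast
        then show "(\<lambda>n. v (s (r n)) k) \<longlonglongrightarrow> \<Phi> L k"
          using v \<Psi>(2) by simp
      qed
      ultimately have "l = \<Phi> L" by (rule LIMSEQ_unique)
      then have "(\<lambda>n. ?I (v (s (r n)))) \<longlonglongrightarrow> ?I l"
        using lim f \<Psi>\<Phi>[OF L] by simp
      from tendstoD[OF this \<open>\<epsilon> > 0\<close>] show False
        using s(1) by simp
    qed
    then show "continuous_map (top_of_set T) euclideanreal (\<lambda>v. \<integral>x. f x \<partial>\<Psi> v)" by simp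
  qed
  then have "homeomorphic_maps (top_of_set T) (prob_measure_space K) \<Psi> \<Phi>"
    unfolding homeomorphic_maps_def using c\<Phi> \<Psi> \<Psi>\<Phi>
    by (auto simp: continuous_map_in_subtopology T_def)
  then have hom: "top_of_set T homeomorphic_space prob_measure_space K"
    unfolding homeomorphic_space_def by blast
  show "compact_space (prob_measure_space K)"
    using homeomorphic_compact_space[OF hom] T by (simp add: compact_space_subtopology)
  show "metrizable_space (prob_measure_space K)"
    using homeomorphic_metrizable_space[OF hom] metrizable_space_subtopology[OF metrizable_space_euclidean]
    by blast
qed

text \<open>A single factor suffices, as the finiteness condition is vacuous over one index. A base
  point must exist in the factor, so the empty space uses the empty index set instead.\<close>

lemma compact_metrizable_imp_NY_compact:
  fixes X :: "'a topology"
  assumes X: "compact_space X" "metrizable_space X"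
  shows "NY_compact X"
proof (cases "topspace X = {}")
  case True
  show ?thesis
  proof (rule NY_compactI[OF X(1), of "{} :: unit set" "\<lambda>_. X" "\<lambda>_. undefined" "\<lambda>_ _. undefined"])
    show "embedding_map X (sigma_product (\<lambda>_::unit. X) (\<lambda>_. undefined) {}) (\<lambda>_ _. undefined)"
      using True X Hausdorff_space_sigma_product[of "{} :: unit set" "\<lambda>_. X"]
      by (intro continuous_imp_embedding_map) auto
  qed auto
next
  case False
  then obtain a where a: "a \<in> topspace X" by blast
  show ?thesis
  proof (rule NY_compactI[OF X(1), of "UNIV :: unit set" "\<lambda>_. X" "\<lambda>_. a" "\<lambda>x _. x"])
    show "embedding_map X (sigma_product (\<lambda>_::unit. X) (\<lambda>_. a) UNIV) (\<lambda>x _. x)"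
    proof (rule continuous_imp_embedding_map)
      show "continuous_map X (sigma_product (\<lambda>_::unit. X) (\<lambda>_. a) UNIV) (\<lambda>x _. x)"
        unfolding sigma_product_def continuous_map_in_subtopology continuous_map_componentwise_UNIV
        by auto
      show "Hausdorff_space (sigma_product (\<lambda>_::unit. X) (\<lambda>_. a) UNIV)"
        using X by (intro Hausdorff_space_sigma_product)
      show "inj_on (\<lambda>x (_::unit). x) (topspace X)"
        by (rule inj_onI) (simp add: fun_eq_iff)
    qed (use X in auto)
  qed (use X a in auto)
qed

theorem mainTheorem5:
  fixes E :: "'e::real_vector topology" and C :: "'e set" and K :: "'k topology"
  shows "(topological_vector_space E \<and> compactin E C \<and> convex C \<and>
            \<not> metrizable_space (subtopology E C) \<longrightarrow>
          \<not> NY_compact (subtopology E C)) \<and>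
         (compact_space K \<and> Hausdorff_space K \<longrightarrow>
          (NY_compact (prob_measure_space K) \<longleftrightarrow> metrizable_space K))"
proof (intro conjI impI iffI)
  assume E: "topological_vector_space E \<and> compactin E C \<and> convex C \<and>
    \<not> metrizable_space (subtopology E C)"
  then show "\<not> NY_compact (subtopology E C)"
    using convex_NY_compact_imp_metrizable[of E C] by blast
next
  assume K: "compact_space K \<and> Hausdorff_space K" and NY: "NY_compact (prob_measure_space K)"
  then have "metrizable_space (prob_measure_space K)"
    using NY_compact_prob_measure_space_imp_metrizable by blast
  then show "metrizable_space K"
    using metrizable_prob_measure_space_imp_metrizable[of K] K by blast
next
  assume "compact_space K \<and> Hausdorff_space K" and "metrizable_space K"
  then show "NY_compact (prob_measure_space K)"
    using compact_metrizable_imp_NY_compact[OF compact_metrizable_prob_measure_space[of K]] by blast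
qed

end
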